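(* Let $t\ge 2$, let $\Gamma$ be a broom graph having at least one directed path on $t$ vertices, let $\Gamma_t$ be its $t$-path simplicial tree, and let $I=I(\Gamma_t)$ be the $t$-path ideal of $\Gamma$. Then: (i) $I^{[\nu(\Gamma_t)]}$ has linear quotients. (ii) If, in addition, $\Gamma$ is a path graph, then $I^{[\nu_0(\Gamma_t)]}$ has linear quotients.
   Context: A rooted tree is a directed tree with a fixed vertex, the root, all edges being directed away from the root. A directed path of length $t-1$ (a directed $t$-path) is a sequence of $t$ distinct vertices $i_1,\ldots,i_t$ such that each $(i_j,i_{j+1})$ is a directed edge. A broom graph of height $h$ is a rooted tree with root $x$ consisting of a handle, which is a directed path of length $h$ (with $h+1$ vertices $x_{0,0}=x,x_{1,0},\dots,x_{h,0}$) starting at $x$, such that all other vertices, not on the handle, are leaves, each being attached to one of the handle vertices $x_{0,0},\dots,x_{h-1,0}$. A path graph, rooted at an endpoint, is a broom graph consisting only of the handle. For a rooted tree $\Gamma$, $\Gamma_t$ is the simplicial complex whose facets are the vertex sets of the directed $t$-paths of $\Gamma$. The $t$-path ideal of $\Gamma$ is the facet ideal $I(\Gamma_t)$, generated by the monomials $x_{i_1}\cdots x_{i_t}$ with $i_1,\dots,i_t$ a directed $t$-path, in the polynomial ring over a field $K$ with variables indexed by the vertices of $\Gamma$. A matching of a simplicial complex $\Delta$ is a set of pairwise disjoint facets; $\nu(\Delta)$ is the maximum size of a matching. Two facets $F,G$ form a gap in $\Delta$ if $F\cap G=\emptyset$ and the only facets of $\Delta$ contained in $F\cup G$ are $F$ and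 $G$. A matching $M$ is restricted if some facet in $M$ forms a gap with every other facet in $M$; $\nu_0(\Delta)$ is the maximum size of a restricted matching. For a squarefree monomial ideal $I$, $I^{[k]}$ is the ideal generated by the squarefree monomials among the minimal monomial generators of $I^k$. A homogeneous ideal $I$ has linear quotients if there is a system of homogeneous generators $f_1,\dots,f_m$ of $I$ such that $(f_1,\dots,f_{i-1}):f_i$ is generated by linear forms for all $i=1,\dots,m$. *)

theory Defs
  imports
    "Graph_Theory.Graph_Theory"
    "HOL-Algebra.Ideal_Product"
    "HOL-Library.Poly_Mapping"
begin

section \<open>Rooted trees, broom graphs, path complexes\<close>

text \<open>
  Directed graphs are the pair digraphs of \<open>Graph_Theory\<close>; \<open>mk_symmetric G\<close> is the underlying
  undirected graph and \<open>vpath p G\<close> says that the nonempty vertex list \<open>p\<close> has distinct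
  entries and that consecutive entries are joined by arcs of \<open>G\<close>.
  The library predicate \<open>tree\<close> is not suitable here: it only forbids directed cycles, so that
  every connected acyclic digraph satisfies it. We require instead that the underlying
  undirected graph is a tree. Its arcs come in antiparallel pairs, so cycles
  must have length at least 3, and \<open>G\<close> must not contain both orientations of an edge.
\<close>

definition directed_tree :: "'v pair_pre_digraph \<Rightarrow> bool" where
  "directed_tree G \<longleftrightarrow>
     pair_digraph G \<and> Digraph_Component.connected (with_proj G) \<and>
     (\<forall>u v. (u, v) \<in> parcs G \<longrightarrow> (v, u) \<notin> parcs G) \<and>
     \<not> (\<exists>p. vpath p (with_proj (mk_symmetric (with_proj G))) \<and> 3 \<le> length p \<and>
            (last p, hd p) \<in> parcs (mk_symmetric (with_proj G)))"

text \<open>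
  An arc \<open>(u, v)\<close> is directed away from the root \<open>r\<close> if it is the last step of the undirected
  path from \<open>r\<close> to \<open>v\<close>.
\<close>

definition rooted_tree :: "'v pair_pre_digraph \<Rightarrow> 'v \<Rightarrow> bool" where
  "rooted_tree G r \<longleftrightarrow>
     directed_tree G \<and> r \<in> pverts G \<and>
     (\<forall>u v. (u, v) \<in> parcs G \<longrightarrow>
        (\<exists>p. vpath (p @ [v]) (with_proj (mk_symmetric (with_proj G))) \<and>
             p \<noteq> [] \<and> hd p = r \<and> last p = u))"

definition broom_handle :: "'v pair_pre_digraph \<Rightarrow> 'v \<Rightarrow> nat \<Rightarrow> 'v list \<Rightarrow> bool" where
  "broom_handle G r h xs \<longleftrightarrow>
     vpath xs (with_proj G) \<and> length xs = h + 1 \<and> hd xs = r \<and>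
     (\<forall>v \<in> pverts G - set xs.
        (\<forall>w. (v, w) \<notin> parcs G) \<and> (\<exists>j<h. (xs ! j, v) \<in> parcs G))"

definition broom_graph :: "'v pair_pre_digraph \<Rightarrow> 'v \<Rightarrow> nat \<Rightarrow> bool" where
  "broom_graph G r h \<longleftrightarrow> rooted_tree G r \<and> (\<exists>xs. broom_handle G r h xs)"

definition path_graph :: "'v pair_pre_digraph \<Rightarrow> 'v \<Rightarrow> bool" where
  "path_graph G r \<longleftrightarrow>
     rooted_tree G r \<and> (\<exists>h xs. broom_handle G r h xs \<and> pverts G = set xs)"

definition directed_path :: "nat \<Rightarrow> 'v pair_pre_digraph \<Rightarrow> 'v list \<Rightarrow> bool" where
  "directed_path t G p \<longleftrightarrow> vpath p (with_proj G) \<and> length p = t"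

text \<open>A simplicial complex is given by its set of faces.\<close>

definition path_complex :: "nat \<Rightarrow> 'v pair_pre_digraph \<Rightarrow> 'v set set" where
  "path_complex t G = {F. \<exists>p. directed_path t G p \<and> F \<subseteq> set p}"

definition facets :: "'v set set \<Rightarrow> 'v set set" where
  "facets \<Delta> = {F \<in> \<Delta>. \<forall>H\<in>\<Delta>. F \<subseteq> H \<longrightarrow> F = H}"


section \<open>Matchings\<close>

definition matching :: "'v set set \<Rightarrow> 'v set set \<Rightarrow> bool" where
  "matching \<Delta> M \<longleftrightarrow> M \<subseteq> facets \<Delta> \<and> (\<forall>F\<in>M. \<forall>H\<in>M. F \<noteq> H \<longrightarrow> F \<inter> H = {})"

definition matching_number :: "'v set set \<Rightarrow> nat" where
  "matching_number \<Delta> = Max (card ` {M. matching \<Delta> M})"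

definition gap :: "'v set set \<Rightarrow> 'v set \<Rightarrow> 'v set \<Rightarrow> bool" where
  "gap \<Delta> F H \<longleftrightarrow>
     F \<in> facets \<Delta> \<and> H \<in> facets \<Delta> \<and> F \<inter> H = {} \<and>
     (\<forall>L \<in> facets \<Delta>. L \<subseteq> F \<union> H \<longrightarrow> L = F \<or> L = H)"

definition restricted_matching :: "'v set set \<Rightarrow> 'v set set \<Rightarrow> bool" where
  "restricted_matching \<Delta> M \<longleftrightarrow>
     matching \<Delta> M \<and> (\<exists>F\<in>M. \<forall>H \<in> M - {F}. gap \<Delta> F H)"

definition restricted_matching_number :: "'v set set \<Rightarrow> nat" where
  "restricted_matching_number \<Delta> = Max (card ` {M. restricted_matching \<Delta> M})"


section \<open>The polynomial ring with variables indexed by a set of vertices\<close>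

type_synonym ('v, 'k) mpoly = "('v \<Rightarrow>\<^sub>0 nat) \<Rightarrow>\<^sub>0 'k"

text \<open>
  \<open>poly_ring V\<close> is the ring $K[x_v : v \in V]$, where the field $K$ is the type \<open>'k\<close>, as a ring in the
  sense of \<open>HOL-Algebra\<close>, so that ideals are ideals of this ring even when \<open>V\<close> is
  a proper subset of the type of vertices.
\<close>

definition poly_ring :: "'v set \<Rightarrow> ('v, 'k::field) mpoly ring" where
  "poly_ring V =
     \<lparr>carrier = {p. \<forall>m \<in> Poly_Mapping.keys p. Poly_Mapping.keys m \<subseteq> V},
      monoid.mult = (*), one = 1, zero = 0, add = (+)\<rparr>"

lemma cring_poly_ring: "cring (poly_ring V :: ('v, 'k::field) mpoly ring)"
proof (rule cringI)
  show "abelian_group (poly_ring V :: ('v, 'k) mpoly ring)"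
  proof (rule abelian_groupI)
    fix p assume "p \<in> carrier (poly_ring V :: ('v, 'k) mpoly ring)"
    then have "- p \<in> carrier (poly_ring V :: ('v, 'k) mpoly ring)"
      by (simp add: poly_ring_def in_keys_iff)
    then show "\<exists>q \<in> carrier (poly_ring V). q \<oplus>\<^bsub>poly_ring V\<^esub> p = \<zero>\<^bsub>poly_ring V\<^esub>"
      by (rule bexI[rotated]) (simp add: poly_ring_def)
  next
    fix p q
    assume "p \<in> carrier (poly_ring V :: ('v, 'k) mpoly ring)"
      and "q \<in> carrier (poly_ring V :: ('v, 'k) mpoly ring)"
    then show "p \<oplus>\<^bsub>poly_ring V\<^esub> q \<in> carrier (poly_ring V)"
      using Poly_Mapping.keys_add[of p q] by (auto simp: poly_ring_def)
  qed (auto simp: poly_ring_def algebra_simps)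
  show "Group.comm_monoid (poly_ring V :: ('v, 'k) mpoly ring)"
  proof (rule comm_monoidI)
    fix p q
    assume pq: "p \<in> carrier (poly_ring V :: ('v, 'k) mpoly ring)"
      "q \<in> carrier (poly_ring V :: ('v, 'k) mpoly ring)"
    show "p \<otimes>\<^bsub>poly_ring V\<^esub> q \<in> carrier (poly_ring V)"
      unfolding poly_ring_def
    proof (simp, intro ballI)
      fix m assume "m \<in> Poly_Mapping.keys (p * q)"
      then obtain a b where "m = a + b" "a \<in> Poly_Mapping.keys p" "b \<in> Poly_Mapping.keys q"
        using keys_mult[of p q] by blast
      then show "Poly_Mapping.keys m \<subseteq> V"
        using pq Poly_Mapping.keys_add[of a b] by (simp add: poly_ring_def) blast
    qed
  qed (auto simp: poly_ring_def algebra_simps)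
qed (auto simp: poly_ring_def algebra_simps)

definition mon_degree :: "('v \<Rightarrow>\<^sub>0 nat) \<Rightarrow> nat" where
  "mon_degree m = (\<Sum>v \<in> Poly_Mapping.keys m. Poly_Mapping.lookup m v)"

text \<open>The zero polynomial is homogeneous of every degree, hence also a linear form.\<close>

definition homogeneous :: "nat \<Rightarrow> ('v, 'k::field) mpoly \<Rightarrow> bool" where
  "homogeneous d p \<longleftrightarrow> (\<forall>m \<in> Poly_Mapping.keys p. mon_degree m = d)"

definition monomials :: "'v set \<Rightarrow> ('v, 'k::field) mpoly set" where
  "monomials V = {Poly_Mapping.single m 1 | m. Poly_Mapping.keys m \<subseteq> V}"

definition squarefree_monomial :: "('v, 'k::field) mpoly \<Rightarrow> bool" where
  "squarefree_monomial u \<longleftrightarrow>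
     (\<exists>m. u = Poly_Mapping.single m 1 \<and> (\<forall>v. Poly_Mapping.lookup m v \<le> 1))"


section \<open>Facet ideals, squarefree powers, linear quotients\<close>

definition facet_monomial :: "'v set \<Rightarrow> ('v, 'k::field) mpoly" where
  "facet_monomial F = (\<Prod>v\<in>F. Poly_Mapping.single (Poly_Mapping.single v 1) 1)"

definition facet_ideal :: "'v set \<Rightarrow> 'v set set \<Rightarrow> ('v, 'k::field) mpoly set" where
  "facet_ideal V \<Delta> = Idl\<^bsub>poly_ring V\<^esub> (facet_monomial ` facets \<Delta>)"

text \<open>
  The minimal monomial generators of a monomial ideal \<open>J\<close>: the unique set of monomials that
  generates \<open>J\<close> while no proper subset of it does.
\<close>

definition min_mon_gens :: "'v set \<Rightarrow> ('v, 'k::field) mpoly set \<Rightarrow> ('v, 'k) mpoly set" where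
  "min_mon_gens V J =
     (THE S. S \<subseteq> monomials V \<and> Idl\<^bsub>poly_ring V\<^esub> S = J \<and>
             (\<forall>T. T \<subset> S \<longrightarrow> Idl\<^bsub>poly_ring V\<^esub> T \<noteq> J))"

text \<open>
  The ordinary power of an ideal is its power in the multiplicative monoid \<open>ideals_set\<close> of ideals,
  whose unit is the whole ring.
\<close>

definition squarefree_power ::
    "'v set \<Rightarrow> ('v, 'k::field) mpoly set \<Rightarrow> nat \<Rightarrow> ('v, 'k) mpoly set" where
  "squarefree_power V J k =
     Idl\<^bsub>poly_ring V\<^esub>
       {u \<in> min_mon_gens V (J [^]\<^bsub>ideals_set (poly_ring V)\<^esub> k). squarefree_monomial u}"

definition colon_ideal :: "('a, 'b) ring_scheme \<Rightarrow> 'a set \<Rightarrow> 'a \<Rightarrow> 'a set" where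
  "colon_ideal R J f = {g \<in> carrier R. g \<otimes>\<^bsub>R\<^esub> f \<in> J}"

definition linear_quotients :: "'v set \<Rightarrow> ('v, 'k::field) mpoly set \<Rightarrow> bool" where
  "linear_quotients V J \<longleftrightarrow>
     (\<exists>fs. set fs \<subseteq> carrier (poly_ring V) \<and>
           (\<forall>f \<in> set fs. \<exists>d. homogeneous d f) \<and>
           Idl\<^bsub>poly_ring V\<^esub> (set fs) = J \<and>
           (\<forall>i < length fs.
              \<exists>L. L \<subseteq> {l \<in> carrier (poly_ring V). homogeneous 1 l} \<and>
                  colon_ideal (poly_ring V) (Idl\<^bsub>poly_ring V\<^esub> (set (take i fs))) (fs ! i) =
                    Idl\<^bsub>poly_ring V\<^esub> L))"

end

theory Submission
  imports Defs
begin

text \<open>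
  In a broom every directed \<open>t\<close>-path is determined by its last vertex \<open>v\<close>: the other \<open>t - 1\<close>
  vertices are the handle vertices immediately above \<open>v\<close>. Matchings of size \<open>k\<close> are therefore sets
  of \<open>k\<close> end vertices, and the \<open>k\<close>-th squarefree power is generated by the products of the
  variables in the unions of such matchings. Linear quotients for an
  ordering of these products means: whenever \<open>Z\<close> comes before \<open>Y\<close>, some matching
  before \<open>Y\<close> covers exactly one vertex that \<open>Y\<close> misses, and \<open>Z\<close> covers this vertex too
  (\<open>linear_quotients_mon_ideal\<close>).

  Matchings are ordered lexicographically: vertices near the root count first, and among vertices
  of one depth the leaves count before the handle vertex. Let \<open>z\<close> be the first end in which \<open>Z\<close>
  and \<open>Y\<close> differ, so that \<open>z\<close> belongs to \<open>Z\<close>, and let \<open>y\<close> be the next end of \<open>Y\<close>. If \<open>y\<close> and \<open>z\<close>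
  have the same depth, then \<open>z\<close> is a leaf and \<open>y\<close> can be replaced by \<open>z\<close>. Otherwise \<open>y\<close> is
  deeper, and its path is shifted one step towards the root along the handle; the
  vertex gained is the one just above the old path, and all that is needed is that the path to
  \<open>z\<close> contains it (\<open>exchangeable\<close>, \<open>end_matching_exchange_towards\<close>).

  Suppose the path to \<open>z\<close> does not contain it. Then \<open>Y\<close> together with \<open>z\<close> is a matching of size
  \<open>k + 1\<close>, which is absurd if \<open>k\<close> is the matching number (\<open>exchangeable_if_maximal\<close>). In a path
  graph these \<open>k + 1\<close> paths moreover leave one of the \<open>h + 1\<close> vertices uncovered, so
  \<open>(k + 1) t \<le> h\<close>. But then the path to the vertex of depth \<open>t - 1\<close>, followed after one skipped
  vertex by \<open>k\<close> consecutive paths, is a restricted matching of size \<open>k + 1\<close>, which is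
  absurd if \<open>k\<close> is the restricted matching number (\<open>exchangeable_path\<close>,
  \<open>exists_spread_end_matching\<close>).
\<close>

section \<open>Exponents and divisibility of monomials\<close>

abbreviation mon :: "('v \<Rightarrow>\<^sub>0 nat) \<Rightarrow> ('v, 'k::field) mpoly" where
  "mon m \<equiv> Poly_Mapping.single m 1"

lemma mon_eq_iff: "mon m = (mon m' :: ('v, 'k::field) mpoly) \<longleftrightarrow> m = m'"
  by (metis keys_single singleton_inject zero_neq_one)

definition mdvd :: "('v \<Rightarrow>\<^sub>0 nat) \<Rightarrow> ('v \<Rightarrow>\<^sub>0 nat) \<Rightarrow> bool" where
  "mdvd a m \<longleftrightarrow> (\<forall>v. Poly_Mapping.lookup a v \<le> Poly_Mapping.lookup m v)"

lemma mdvd_refl [simp]: "mdvd a a"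
  by (simp add: mdvd_def)

lemma mdvd_trans: "mdvd a b \<Longrightarrow> mdvd b c \<Longrightarrow> mdvd a c"
  unfolding mdvd_def using le_trans by blast

lemma mdvd_add: "mdvd a b \<Longrightarrow> mdvd c d \<Longrightarrow> mdvd (a + c) (b + d)"
  by (simp add: mdvd_def lookup_add add_mono)

lemma mdvdE:
  assumes "mdvd a m"
  obtains c where "m = c + a"
proof
  show "m = (m - a) + a"
    using assms by (intro poly_mapping_eqI) (simp add: lookup_add lookup_minus mdvd_def)
qed

lemma keys_add_nat: "Poly_Mapping.keys (a + b) = Poly_Mapping.keys a \<union> Poly_Mapping.keys (b :: 'v \<Rightarrow>\<^sub>0 nat)"
  by (auto simp: in_keys_iff lookup_add)

lemma mon_degree_superset:
  assumes "finite S" "Poly_Mapping.keys m \<subseteq> S"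
  shows "mon_degree m = (\<Sum>v\<in>S. Poly_Mapping.lookup m v)"
  unfolding mon_degree_def using assms by (intro sum.mono_neutral_left) (auto simp: in_keys_iff)

lemma mon_degree_add: "mon_degree (a + b) = mon_degree a + mon_degree b"
proof -
  let ?S = "Poly_Mapping.keys a \<union> Poly_Mapping.keys b"
  have "mon_degree (a + b) = (\<Sum>v\<in>?S. Poly_Mapping.lookup (a + b) v)"
    by (intro mon_degree_superset) (auto simp: keys_add_nat)
  also have "\<dots> = (\<Sum>v\<in>?S. Poly_Mapping.lookup a v) + (\<Sum>v\<in>?S. Poly_Mapping.lookup b v)"
    by (simp add: lookup_add sum.distrib)
  also have "\<dots> = mon_degree a + mon_degree b"
    using mon_degree_superset[of ?S a] mon_degree_superset[of ?S b] by simp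
  finally show ?thesis .
qed

lemma mon_degree_eq_0: "mon_degree m = 0 \<longleftrightarrow> m = 0"
  by (auto simp: mon_degree_def in_keys_iff intro!: poly_mapping_eqI)

lemma mdvd_same_degree:
  assumes "mdvd a b" "mon_degree a = mon_degree b"
  shows "a = b"
proof -
  obtain c where c: "b = c + a" using assms(1) by (rule mdvdE)
  with assms(2) have "c = 0" by (simp add: mon_degree_add mon_degree_eq_0)
  with c show ?thesis by simp
qed


section \<open>Monomial ideals\<close>

text \<open>
  Membership in a monomial ideal can be tested on each monomial of a polynomial separately.
  Taking this test as the definition reduces computations with ideals to divisibility of exponents;
  \<open>Idl_mon\<close> identifies the result with the generated ideal.
\<close>

definition mon_ideal :: "'v set \<Rightarrow> ('v \<Rightarrow>\<^sub>0 nat) set \<Rightarrow> ('v, 'k::field) mpoly set" where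
  "mon_ideal V A = {p \<in> carrier (poly_ring V). \<forall>m\<in>Poly_Mapping.keys p. \<exists>a\<in>A. mdvd a m}"

lemma carrier_poly_ring: "p \<in> carrier (poly_ring V) \<longleftrightarrow> (\<forall>m\<in>Poly_Mapping.keys p. Poly_Mapping.keys m \<subseteq> V)"
  by (simp add: poly_ring_def)

lemma poly_ring_simps [simp]:
  "p \<otimes>\<^bsub>poly_ring V\<^esub> q = p * q" "p \<oplus>\<^bsub>poly_ring V\<^esub> q = p + q" "\<zero>\<^bsub>poly_ring V\<^esub> = 0" "\<one>\<^bsub>poly_ring V\<^esub> = 1"
  by (simp_all add: poly_ring_def)

lemma ring_poly_ring: "ring (poly_ring V)"
  using cring_poly_ring by (rule cring.axioms)

lemma mon_in_carrier [simp]: "mon m \<in> carrier (poly_ring V) \<longleftrightarrow> Poly_Mapping.keys m \<subseteq> V"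
  by (simp add: carrier_poly_ring)

lemma in_mon_ideal:
  "p \<in> mon_ideal V A \<longleftrightarrow> (\<forall>m\<in>Poly_Mapping.keys p. Poly_Mapping.keys m \<subseteq> V \<and> (\<exists>a\<in>A. mdvd a m))"
  by (auto simp: mon_ideal_def carrier_poly_ring)

lemma mon_in_mon_ideal:
  "mon m \<in> (mon_ideal V A :: ('v, 'k::field) mpoly set) \<longleftrightarrow> Poly_Mapping.keys m \<subseteq> V \<and> (\<exists>a\<in>A. mdvd a m)"
  by (simp add: in_mon_ideal)

lemma mon_gen_in_mon_ideal: "a \<in> A \<Longrightarrow> Poly_Mapping.keys a \<subseteq> V \<Longrightarrow> mon a \<in> mon_ideal V A"
  unfolding mon_in_mon_ideal using mdvd_refl by blast

lemma mon_ideal_add: "p \<in> mon_ideal V A \<Longrightarrow> q \<in> mon_ideal V A \<Longrightarrow> p + q \<in> mon_ideal V A"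
  using Poly_Mapping.keys_add[of p q] by (auto simp: in_mon_ideal)

lemma mon_ideal_mult:
  assumes "p \<in> mon_ideal V A" "q \<in> mon_ideal V B"
  shows "p * q \<in> mon_ideal V ((\<lambda>(a, b). a + b) ` (A \<times> B))"
  unfolding in_mon_ideal
proof
  fix m assume "m \<in> Poly_Mapping.keys (p * q)"
  then obtain a b where m: "m = a + b" "a \<in> Poly_Mapping.keys p" "b \<in> Poly_Mapping.keys q"
    using keys_mult[of p q] by blast
  then obtain a' b' where "a' \<in> A" "b' \<in> B" "mdvd a' a" "mdvd b' b"
    using assms unfolding in_mon_ideal by blast
  with m assms show "Poly_Mapping.keys m \<subseteq> V \<and> (\<exists>c\<in>(\<lambda>(a, b). a + b) ` (A \<times> B). mdvd c m)"
    by (fastforce simp: in_mon_ideal keys_add_nat intro: mdvd_add)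
qed

lemma mon_ideal_zero: "mon_ideal V {0} = carrier (poly_ring V)"
  by (auto simp: mon_ideal_def mdvd_def)

lemma ideal_mon_ideal: "ideal (mon_ideal V A :: ('v, 'k::field) mpoly set) (poly_ring V)"
proof (rule idealI)
  let ?J = "mon_ideal V A :: ('v, 'k) mpoly set"
  interpret ring "poly_ring V :: ('v, 'k) mpoly ring" by (rule ring_poly_ring)
  show "ring (poly_ring V :: ('v, 'k) mpoly ring)" by (rule ring_poly_ring)
  show "subgroup ?J (add_monoid (poly_ring V))"
  proof (rule add.subgroupI)
    show "?J \<subseteq> carrier (poly_ring V)" by (auto simp: mon_ideal_def)
    show "?J \<noteq> {}" using in_mon_ideal[of 0 V A] by auto
    fix p :: "('v, 'k) mpoly" assume p: "p \<in> ?J"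
    then have "p \<in> carrier (poly_ring V)" by (simp add: mon_ideal_def)
    moreover have "- p \<in> carrier (poly_ring V)" "- p \<in> ?J"
      using p by (simp_all add: in_mon_ideal carrier_poly_ring in_keys_iff)
    ultimately have "\<ominus>\<^bsub>poly_ring V\<^esub> p = - p"
      by (intro minus_equality) auto
    then show "\<ominus>\<^bsub>poly_ring V\<^esub> p \<in> ?J" using \<open>- p \<in> ?J\<close> by simp
  next
    fix p q :: "('v, 'k) mpoly" assume "p \<in> ?J" "q \<in> ?J"
    then show "p \<oplus>\<^bsub>poly_ring V\<^esub> q \<in> ?J" by (simp add: mon_ideal_add)
  qed
  fix p q :: "('v, 'k) mpoly" assume p: "p \<in> ?J" and q: "q \<in> carrier (poly_ring V)"
  from q have "q \<in> mon_ideal V {0}" by (simp add: mon_ideal_zero)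
  with p have "p * q \<in> ?J" using mon_ideal_mult[of p V A q "{0}"] by (simp add: image_def)
  then show "p \<otimes>\<^bsub>poly_ring V\<^esub> q \<in> ?J" "q \<otimes>\<^bsub>poly_ring V\<^esub> p \<in> ?J"
    by (simp_all add: mult.commute)
qed

lemma sum_single: "p = (\<Sum>m\<in>Poly_Mapping.keys p. Poly_Mapping.single m (Poly_Mapping.lookup p m))"
  by (rule poly_mapping_eqI)
    (simp add: lookup_sum lookup_single when_def in_keys_iff sum.delta)

lemma lookup_mult_mon: "Poly_Mapping.lookup (p * mon u) (m + u) = Poly_Mapping.lookup (p :: ('v, 'k::field) mpoly) m"
proof -
  have "p * mon u = (\<Sum>n\<in>Poly_Mapping.keys p. Poly_Mapping.single (n + u) (Poly_Mapping.lookup p n))"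
    using arg_cong[OF sum_single[of p], of "\<lambda>q. q * mon u"] by (simp add: sum_distrib_right mult_single)
  then show ?thesis
    by (simp add: lookup_sum lookup_single when_def in_keys_iff sum.delta)
qed

text \<open>
  Each term of a member is a multiple of a generator, so any ideal containing the generators
  contains all terms and hence their sum.
\<close>

lemma mon_ideal_subset_ideal:
  assumes J: "ideal J (poly_ring V :: ('v, 'k::field) mpoly ring)" and gen: "mon ` A \<subseteq> J"
  shows "mon_ideal V A \<subseteq> J"
proof
  interpret J: ideal J "poly_ring V :: ('v, 'k) mpoly ring" by (rule J)
  fix p :: "('v, 'k) mpoly" assume p: "p \<in> mon_ideal V A"
  have "Poly_Mapping.single m (Poly_Mapping.lookup p m) \<in> J" if m: "m \<in> Poly_Mapping.keys p" for m
  proof -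
    from m p obtain a where a: "a \<in> A" "mdvd a m" and mV: "Poly_Mapping.keys m \<subseteq> V"
      by (auto simp: in_mon_ideal)
    from a(2) obtain c where c: "m = c + a" by (rule mdvdE)
    then have "Poly_Mapping.single c (Poly_Mapping.lookup p m) \<in> carrier (poly_ring V)"
      using mV by (simp add: carrier_poly_ring keys_add_nat)
    with gen a have "Poly_Mapping.single c (Poly_Mapping.lookup p m) * mon a \<in> J"
      using J.I_l_closed[of "mon a" "Poly_Mapping.single c (Poly_Mapping.lookup p m)"] by auto
    with c show ?thesis by (simp add: mult_single)
  qed
  moreover have "(\<Sum>m\<in>S. Poly_Mapping.single m (Poly_Mapping.lookup p m)) \<in> J"
    if "finite S" "\<And>m. m \<in> S \<Longrightarrow> Poly_Mapping.single m (Poly_Mapping.lookup p m) \<in> J" for S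
    using that J.additive_subgroup_axioms additive_subgroup.zero_closed additive_subgroup.a_closed
    by (induction S) fastforce+
  ultimately have "(\<Sum>m\<in>Poly_Mapping.keys p. Poly_Mapping.single m (Poly_Mapping.lookup p m)) \<in> J"
    by simp
  then show "p \<in> J"
    using sum_single[of p] by simp
qed

lemma Idl_mon:
  assumes "\<And>a. a \<in> A \<Longrightarrow> Poly_Mapping.keys a \<subseteq> V"
  shows "Idl\<^bsub>poly_ring V\<^esub> (mon ` A) = (mon_ideal V A :: ('v, 'k::field) mpoly set)"
proof
  interpret ring "poly_ring V :: ('v, 'k) mpoly ring" by (rule ring_poly_ring)
  have "mon ` A \<subseteq> (mon_ideal V A :: ('v, 'k) mpoly set)"
    using assms by (auto intro: mon_gen_in_mon_ideal)
  with ideal_mon_ideal show "Idl\<^bsub>poly_ring V\<^esub> (mon ` A) \<subseteq> (mon_ideal V A :: ('v, 'k) mpoly set)"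
    by (rule genideal_minimal)
  have "mon ` A \<subseteq> carrier (poly_ring V :: ('v, 'k) mpoly ring)"
    using assms by auto
  then show "mon_ideal V A \<subseteq> Idl\<^bsub>poly_ring V\<^esub> (mon ` A :: ('v, 'k) mpoly set)"
    by (intro mon_ideal_subset_ideal genideal_ideal genideal_self)
qed

lemma ideal_prod_mon_ideal:
  assumes A: "\<And>a. a \<in> A \<Longrightarrow> Poly_Mapping.keys a \<subseteq> V" and B: "\<And>b. b \<in> B \<Longrightarrow> Poly_Mapping.keys b \<subseteq> V"
  shows "ideal_prod (poly_ring V) (mon_ideal V A) (mon_ideal V B) =
    (mon_ideal V ((\<lambda>(a, b). a + b) ` (A \<times> B)) :: ('v, 'k::field) mpoly set)" (is "?L = ?R")
proof
  interpret ring "poly_ring V :: ('v, 'k) mpoly ring" by (rule ring_poly_ring)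
  show "?L \<subseteq> ?R"
  proof
    fix p assume "p \<in> ?L"
    then show "p \<in> ?R"
    proof induction
      case (prod p q)
      then show ?case by (simp add: mon_ideal_mult)
    next
      case (sum p q)
      then show ?case by (simp add: mon_ideal_add)
    qed
  qed
  have "ideal ?L (poly_ring V)"
    by (intro ideal_prod_is_ideal ideal_mon_ideal)
  moreover have "mon ` ((\<lambda>(a, b). a + b) ` (A \<times> B)) \<subseteq> ?L"
  proof clarsimp
    fix a b assume "a \<in> A" "b \<in> B"
    then have "mon a \<in> (mon_ideal V A :: ('v, 'k) mpoly set)" "mon b \<in> (mon_ideal V B :: ('v, 'k) mpoly set)"
      using A B by (auto intro: mon_gen_in_mon_ideal)
    then have "mon a * mon b \<in> ?L"
      using ideal_prod.prod[of "mon a" "mon_ideal V A" "mon b" "mon_ideal V B" "poly_ring V"] by simp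
    then show "mon (a + b) \<in> ?L" by (simp add: mult_single)
  qed
  ultimately show "?R \<subseteq> ?L" by (rule mon_ideal_subset_ideal)
qed

text \<open>
  The exponents of the products of \<open>k\<close> generators, that is, the \<open>k\<close>-fold sumset of \<open>A\<close>.
\<close>

fun sums_of :: "('v \<Rightarrow>\<^sub>0 nat) set \<Rightarrow> nat \<Rightarrow> ('v \<Rightarrow>\<^sub>0 nat) set" where
  "sums_of A 0 = {0}"
| "sums_of A (Suc k) = (\<lambda>(a, b). a + b) ` (sums_of A k \<times> A)"

lemma sums_of_keys:
  assumes "\<And>a. a \<in> A \<Longrightarrow> Poly_Mapping.keys a \<subseteq> V" "m \<in> sums_of A k"
  shows "Poly_Mapping.keys m \<subseteq> V"
  using assms(2)
proof (induction k arbitrary: m)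
  case (Suc k)
  then obtain a b where "m = a + b" "a \<in> sums_of A k" "b \<in> A" by auto
  with Suc.IH assms(1) show ?case by (simp add: keys_add_nat)
qed simp

lemma sums_of_degree:
  assumes "\<And>a. a \<in> A \<Longrightarrow> mon_degree a = n" "m \<in> sums_of A k"
  shows "mon_degree m = k * n"
  using assms(2)
proof (induction k arbitrary: m)
  case (Suc k)
  then obtain a b where "m = a + b" "a \<in> sums_of A k" "b \<in> A" by auto
  with Suc.IH[of a] assms(1)[of b] show ?case by (simp add: mon_degree_add)
qed (simp add: mon_degree_eq_0)

lemma mon_ideal_power:
  assumes "\<And>a. a \<in> A \<Longrightarrow> Poly_Mapping.keys a \<subseteq> V"
  shows "mon_ideal V A [^]\<^bsub>ideals_set (poly_ring V)\<^esub> (k :: nat) =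
    (mon_ideal V (sums_of A k) :: ('v, 'k::field) mpoly set)"
proof (induction k)
  case 0
  show ?case by (simp add: nat_pow_def ideals_set_def mon_ideal_zero)
next
  case (Suc k)
  have "mon_ideal V A [^]\<^bsub>ideals_set (poly_ring V)\<^esub> Suc k =
    ideal_prod (poly_ring V) (mon_ideal V A [^]\<^bsub>ideals_set (poly_ring V)\<^esub> k) (mon_ideal V A :: ('v, 'k) mpoly set)"
    by (simp add: nat_pow_def ideals_set_def)
  also have "\<dots> = mon_ideal V (sums_of A (Suc k))"
    unfolding Suc using assms sums_of_keys[OF assms] by (subst ideal_prod_mon_ideal) auto
  finally show ?case .
qed

text \<open>
  Monomials of one degree do not divide each other. Hence no generator can be dropped.
  Conversely, a monomial generating set \<open>S\<close> of the same ideal contains a divisor \<open>b\<close> of each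
  generator \<open>a\<close>, and \<open>b\<close> is in turn divisible by a generator, which can only be \<open>a\<close>; so \<open>S\<close>
  contains \<open>a\<close>, and minimality of \<open>S\<close> excludes further elements.
\<close>

lemma min_mon_gens_eq:
  assumes V: "\<And>a. a \<in> A \<Longrightarrow> Poly_Mapping.keys a \<subseteq> V" and deg: "\<And>a. a \<in> A \<Longrightarrow> mon_degree a = n"
  shows "min_mon_gens V (mon_ideal V A) = (mon ` A :: ('v, 'k::field) mpoly set)"
  unfolding min_mon_gens_def
proof (rule the_equality, intro conjI allI impI)
  show sub: "mon ` A \<subseteq> (monomials V :: ('v, 'k) mpoly set)"
    using V by (auto simp: monomials_def)
  show "Idl\<^bsub>poly_ring V\<^esub> (mon ` A) = (mon_ideal V A :: ('v, 'k) mpoly set)"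
    using V by (rule Idl_mon)
  fix T :: "('v, 'k) mpoly set" assume T: "T \<subset> mon ` A"
  then obtain B where B: "B \<subseteq> A" "T = mon ` B" by (meson psubset_imp_subset subset_imageE)
  with T obtain a where a: "a \<in> A" "a \<notin> B" by blast
  have "mon a \<in> (mon_ideal V A :: ('v, 'k) mpoly set)"
    using a V by (auto intro: mon_gen_in_mon_ideal)
  moreover have "mon a \<notin> (mon_ideal V B :: ('v, 'k) mpoly set)"
  proof
    assume "mon a \<in> (mon_ideal V B :: ('v, 'k) mpoly set)"
    then obtain b where "b \<in> B" "mdvd b a" by (auto simp: mon_in_mon_ideal)
    with a B deg show False using mdvd_same_degree[of b a] by auto
  qed
  moreover have "Idl\<^bsub>poly_ring V\<^esub> T = mon_ideal V B"
    unfolding B(2) using B V by (intro Idl_mon) auto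
  ultimately show "Idl\<^bsub>poly_ring V\<^esub> T \<noteq> mon_ideal V A" by auto
next
  fix S :: "('v, 'k) mpoly set"
  assume "S \<subseteq> monomials V \<and> Idl\<^bsub>poly_ring V\<^esub> S = mon_ideal V A \<and>
             (\<forall>T. T \<subset> S \<longrightarrow> Idl\<^bsub>poly_ring V\<^esub> T \<noteq> mon_ideal V A)"
  then have S: "S \<subseteq> monomials V" "Idl\<^bsub>poly_ring V\<^esub> S = mon_ideal V A"
    and S_min: "\<And>T. T \<subset> S \<Longrightarrow> Idl\<^bsub>poly_ring V\<^esub> T \<noteq> mon_ideal V A"
    by simp_all
  define B where "B = {m. mon m \<in> S}"
  have SB: "S = mon ` B" using S(1) by (auto simp: B_def monomials_def)
  have BV: "Poly_Mapping.keys b \<subseteq> V" if "b \<in> B" for b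
  proof -
    have "mon b \<in> (monomials V :: ('v, 'k) mpoly set)" using that S(1) by (auto simp: B_def)
    then show ?thesis by (auto simp: monomials_def mon_eq_iff)
  qed
  have eq: "mon_ideal V B = (mon_ideal V A :: ('v, 'k) mpoly set)"
    using S(2) Idl_mon[of B V] BV unfolding SB by metis
  have "A \<subseteq> B"
  proof
    fix a assume a: "a \<in> A"
    then have "mon a \<in> (mon_ideal V A :: ('v, 'k) mpoly set)"
      using V by (auto intro: mon_gen_in_mon_ideal)
    then obtain b where b: "b \<in> B" "mdvd b a"
      unfolding eq[symmetric] by (auto simp: mon_in_mon_ideal)
    then have "mon b \<in> (mon_ideal V B :: ('v, 'k) mpoly set)"
      using BV by (auto intro: mon_gen_in_mon_ideal)
    then obtain a' where a': "a' \<in> A" "mdvd a' b"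
      unfolding eq by (auto simp: mon_in_mon_ideal)
    then have "a' = a" using b a deg mdvd_same_degree[of a' a] mdvd_trans by metis
    then have "b = a" using a' b by (auto simp: mdvd_def intro!: poly_mapping_eqI le_antisym)
    with b show "a \<in> B" by simp
  qed
  moreover have "\<not> mon ` A \<subset> S"
    using S_min Idl_mon[of A V] V by blast
  ultimately show "S = mon ` A"
    unfolding SB by blast
qed

section \<open>Squarefree powers and linear quotients\<close>

definition indicator_exp :: "'v set \<Rightarrow> 'v \<Rightarrow>\<^sub>0 nat" where
  "indicator_exp F = (\<Sum>v\<in>F. Poly_Mapping.single v 1)"

lemma lookup_indicator_exp:
  "finite F \<Longrightarrow> Poly_Mapping.lookup (indicator_exp F) v = (if v \<in> F then 1 else 0)"
  by (simp add: indicator_exp_def lookup_sum lookup_single when_def)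

lemma keys_indicator_exp: "finite F \<Longrightarrow> Poly_Mapping.keys (indicator_exp F) = F"
  by (auto simp: in_keys_iff lookup_indicator_exp split: if_splits)

lemma mon_degree_indicator_exp: "finite F \<Longrightarrow> mon_degree (indicator_exp F) = card F"
  by (simp add: mon_degree_def keys_indicator_exp lookup_indicator_exp)

lemma facet_monomial_eq: "facet_monomial F = mon (indicator_exp F)"
  unfolding facet_monomial_def indicator_exp_def
  by (induction F rule: infinite_finite_induct) (simp_all add: mult_single)

lemma indicator_exp_Un:
  "finite F \<Longrightarrow> finite H \<Longrightarrow> F \<inter> H = {} \<Longrightarrow> indicator_exp (F \<union> H) = indicator_exp F + indicator_exp H"
  by (simp add: indicator_exp_def sum.union_disjoint)

lemma squarefree_monomial_mon:
  "squarefree_monomial (mon m :: ('v, 'k::field) mpoly) \<longleftrightarrow> (\<forall>v. Poly_Mapping.lookup m v \<le> 1)"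
proof -
  show ?thesis by (auto simp: squarefree_monomial_def mon_eq_iff)
qed

text \<open>
  For a pure complex all \<open>k\<close>-fold products of facet monomials have the same degree, so they are
  the minimal generators of the \<open>k\<close>-th power, and the squarefree power keeps the squarefree ones.
\<close>

lemma squarefree_power_facet_ideal:
  assumes F: "\<And>F. F \<in> facets \<Delta> \<Longrightarrow> F \<subseteq> V \<and> card F = n" and fin: "finite V"
  shows "squarefree_power V (facet_ideal V \<Delta>) k =
    (mon_ideal V {m \<in> sums_of (indicator_exp ` facets \<Delta>) k. \<forall>v. Poly_Mapping.lookup m v \<le> 1}
      :: ('v, 'k::field) mpoly set)"
proof -
  let ?A = "indicator_exp ` facets \<Delta>"
  let ?S = "{m \<in> sums_of ?A k. \<forall>v. Poly_Mapping.lookup m v \<le> 1}"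
  have finF: "finite F" if "F \<in> facets \<Delta>" for F
    using F[OF that] fin finite_subset by auto
  have V: "Poly_Mapping.keys a \<subseteq> V" and deg: "mon_degree a = n" if "a \<in> ?A" for a
    using that F finF by (fastforce simp: keys_indicator_exp mon_degree_indicator_exp)+
  have "facet_ideal V \<Delta> = (mon_ideal V ?A :: ('v, 'k) mpoly set)"
    using Idl_mon[of ?A V] V by (simp add: facet_ideal_def facet_monomial_eq image_image)
  then have "facet_ideal V \<Delta> [^]\<^bsub>ideals_set (poly_ring V)\<^esub> k = (mon_ideal V (sums_of ?A k) :: ('v, 'k) mpoly set)"
    using mon_ideal_power[of ?A V k] V by simp
  moreover have "min_mon_gens V (mon_ideal V (sums_of ?A k)) = (mon ` sums_of ?A k :: ('v, 'k) mpoly set)"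
    using sums_of_keys[OF V] sums_of_degree[OF deg] by (rule min_mon_gens_eq)
  ultimately have "min_mon_gens V (facet_ideal V \<Delta> [^]\<^bsub>ideals_set (poly_ring V)\<^esub> k) = (mon ` sums_of ?A k :: ('v, 'k) mpoly set)"
    by simp
  then have "squarefree_power V (facet_ideal V \<Delta>) k =
    Idl\<^bsub>poly_ring V\<^esub> {u \<in> mon ` sums_of ?A k. squarefree_monomial (u :: ('v, 'k) mpoly)}"
    by (simp add: squarefree_power_def)
  also have "{u \<in> mon ` sums_of ?A k. squarefree_monomial (u :: ('v, 'k) mpoly)} = mon ` ?S"
    by (auto simp: squarefree_monomial_mon)
  also have "Idl\<^bsub>poly_ring V\<^esub> (mon ` ?S) = (mon_ideal V ?S :: ('v, 'k) mpoly set)"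
    using sums_of_keys[OF V] by (intro Idl_mon) auto
  finally show ?thesis .
qed

text \<open>
  The colon ideal at position \<open>i\<close> is generated by the quotients of the earlier generators by
  their greatest common divisor with the \<open>i\<close>-th one. The exchange hypothesis provides, for
  each of these quotients, a variable dividing it that is itself such a quotient. In particular
  an earlier set is never contained in a later one, so repetitions are excluded.
\<close>

lemma linear_quotients_mon_ideal:
  assumes fin: "finite V" and V: "\<And>U. U \<in> set Us \<Longrightarrow> U \<subseteq> V"
    and exch: "\<And>i j. j < i \<Longrightarrow> i < length Us \<Longrightarrow> \<exists>l<i. \<exists>v. Us ! l - Us ! i = {v} \<and> v \<in> Us ! j"
  shows "linear_quotients V (mon_ideal V (indicator_exp ` set Us) :: ('v, 'k::field) mpoly set)"
  unfolding linear_quotients_def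
proof (intro exI[of _ "map (\<lambda>U. mon (indicator_exp U)) Us"] conjI)
  let ?fs = "map (\<lambda>U. mon (indicator_exp U)) Us :: ('v, 'k) mpoly list"
  have finU: "finite U" if "U \<in> set Us" for U
    using V[OF that] fin finite_subset by auto
  have keys: "Poly_Mapping.keys a \<subseteq> V" if "a \<in> indicator_exp ` set Us" for a
    using that V finU by (fastforce simp: keys_indicator_exp)
  show "set ?fs \<subseteq> carrier (poly_ring V)"
    using keys by auto
  show "\<forall>f\<in>set ?fs. \<exists>d. homogeneous d f"
    by (auto simp: homogeneous_def)
  show "Idl\<^bsub>poly_ring V\<^esub> (set ?fs) = mon_ideal V (indicator_exp ` set Us)"
    using Idl_mon[of "indicator_exp ` set Us" V] keys by (simp add: image_image)
  show "\<forall>i<length ?fs. \<exists>L. L \<subseteq> {l \<in> carrier (poly_ring V). homogeneous 1 l} \<and>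
      colon_ideal (poly_ring V) (Idl\<^bsub>poly_ring V\<^esub> (set (take i ?fs))) (?fs ! i) = Idl\<^bsub>poly_ring V\<^esub> L"
  proof (intro allI impI)
    fix i assume "i < length ?fs"
    then have i: "i < length Us" by simp
    define A where "A = indicator_exp ` set (take i Us)"
    define u where "u = indicator_exp (Us ! i)"
    \<comment> \<open>The variables of the colon ideal; they generate it.\<close>
    define W where "W = {v \<in> V. \<exists>a\<in>A. mdvd a (Poly_Mapping.single v 1 + u)}"
    define L :: "('v, 'k) mpoly set" where "L = mon ` (\<lambda>v. Poly_Mapping.single v 1) ` W"
    have Ui: "Us ! i \<in> set Us" using i by simp
    have uV: "Poly_Mapping.keys u \<subseteq> V"
      using Ui finU V by (simp add: u_def keys_indicator_exp)
    have AV: "Poly_Mapping.keys a \<subseteq> V" if "a \<in> A" for a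
      using that keys set_take_subset[of i Us] by (auto simp: A_def)
    have "Idl\<^bsub>poly_ring V\<^esub> (set (take i ?fs)) = (mon_ideal V A :: ('v, 'k) mpoly set)"
      using Idl_mon[of A V] AV by (simp add: A_def image_image take_map)
    moreover have "Idl\<^bsub>poly_ring V\<^esub> L = mon_ideal V ((\<lambda>v. Poly_Mapping.single v 1) ` W)"
      unfolding L_def by (intro Idl_mon) (auto simp: W_def)
    moreover have "colon_ideal (poly_ring V) (mon_ideal V A) (mon u) =
      (mon_ideal V ((\<lambda>v. Poly_Mapping.single v 1) ` W) :: ('v, 'k) mpoly set)"
    proof -
      have keys_shift: "Poly_Mapping.keys (g * mon u) = (\<lambda>m. m + u) ` Poly_Mapping.keys g" for g :: "('v, 'k) mpoly"
      proof
        show "Poly_Mapping.keys (g * mon u) \<subseteq> (\<lambda>m. m + u) ` Poly_Mapping.keys g"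
          using keys_mult[of g "mon u :: ('v, 'k) mpoly"] by auto
        have "Poly_Mapping.lookup (g * mon u) (m + u) = Poly_Mapping.lookup g m" for m
          by (rule lookup_mult_mon)
        then show "(\<lambda>m. m + u) ` Poly_Mapping.keys g \<subseteq> Poly_Mapping.keys (g * mon u)"
          by (auto simp: in_keys_iff)
      qed
      have "(\<exists>a\<in>A. mdvd a (m + u)) \<longleftrightarrow> (\<exists>v\<in>W. mdvd (Poly_Mapping.single v 1) m)"
        if "Poly_Mapping.keys m \<subseteq> V" for m
      proof
        assume "\<exists>a\<in>A. mdvd a (m + u)"
        then obtain j where j: "j < i" "mdvd (indicator_exp (Us ! j)) (m + u)"
          using i by (auto simp: A_def in_set_conv_nth)
        then obtain l v where l: "l < i" "Us ! l - Us ! i = {v}" "v \<in> Us ! j"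
          using exch i by blast
        have mem: "Us ! j \<in> set Us" "Us ! l \<in> set Us" using i j l by auto
        have "Poly_Mapping.lookup (indicator_exp (Us ! j)) v \<le> Poly_Mapping.lookup (m + u) v"
          using j(2) by (simp add: mdvd_def)
        moreover have "v \<notin> Us ! i" using l(2) by blast
        ultimately have "1 \<le> Poly_Mapping.lookup m v"
          using l(3) mem Ui finU by (simp add: u_def lookup_add lookup_indicator_exp)
        then have "mdvd (Poly_Mapping.single v 1) m"
          by (simp add: mdvd_def lookup_single when_def)
        moreover have "Us ! l \<subseteq> insert v (Us ! i)" using l(2) by blast
        then have "mdvd (indicator_exp (Us ! l)) (Poly_Mapping.single v 1 + u)"
          using \<open>Us ! l \<subseteq> insert v (Us ! i)\<close> mem Ui finU
          by (auto simp: mdvd_def u_def lookup_add lookup_indicator_exp lookup_single when_def)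
        moreover have "indicator_exp (Us ! l) \<in> A"
          using l(1) i nth_mem[of l "take i Us"] by (auto simp: A_def)
        moreover have "v \<in> V" using l(2) V[OF mem(2)] by blast
        ultimately show "\<exists>v\<in>W. mdvd (Poly_Mapping.single v 1) m"
          by (auto simp: W_def)
      next
        assume "\<exists>v\<in>W. mdvd (Poly_Mapping.single v 1) m"
        then obtain v a where "a \<in> A" "mdvd a (Poly_Mapping.single v 1 + u)" "mdvd (Poly_Mapping.single v 1) m"
          by (auto simp: W_def)
        then show "\<exists>a\<in>A. mdvd a (m + u)"
          using mdvd_add[of _ m u u] mdvd_trans mdvd_refl by blast
      qed
      then have "g \<in> carrier (poly_ring V) \<and> g * mon u \<in> mon_ideal V A \<longleftrightarrow>
          g \<in> mon_ideal V ((\<lambda>v. Poly_Mapping.single v 1) ` W)" for g :: "('v, 'k) mpoly"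
        using uV unfolding in_mon_ideal carrier_poly_ring keys_shift ball_simps keys_add_nat Un_subset_iff bex_simps
        by meson
      then show ?thesis
        by (auto simp: colon_ideal_def)
    qed
    moreover have "L \<subseteq> {l \<in> carrier (poly_ring V). homogeneous 1 l}"
      by (auto simp: L_def W_def homogeneous_def mon_degree_def)
    ultimately show "\<exists>L. L \<subseteq> {l \<in> carrier (poly_ring V). homogeneous 1 l} \<and>
      colon_ideal (poly_ring V) (Idl\<^bsub>poly_ring V\<^esub> (set (take i ?fs))) (?fs ! i) = Idl\<^bsub>poly_ring V\<^esub> L"
      using i by (intro exI[of _ L]) (simp add: u_def)
  qed
qed

section \<open>A lexicographic order on finite sets\<close>

text \<open>
  For subsets of \<open>V\<close> this is lexicographic order, with \<open>V\<close> listed by decreasing \<open>\<sigma>\<close>: of two sets, the one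
  containing the first vertex at which they differ comes first.
\<close>

definition precedes :: "'v set \<Rightarrow> ('v \<Rightarrow> nat) \<Rightarrow> 'v set \<Rightarrow> 'v set \<Rightarrow> bool" where
  "precedes V \<sigma> Z Y \<longleftrightarrow> (\<exists>z\<in>Z - Y. \<forall>v\<in>V. \<sigma> z < \<sigma> v \<longrightarrow> (v \<in> Z \<longleftrightarrow> v \<in> Y))"

text \<open>
  With digit positions given by \<open>\<sigma>\<close>, the order is the comparison of binary numbers: the digit at
  the first difference outweighs all lower ones together. This makes it an order by a
  numerical weight, by which a list can be sorted.
\<close>

lemma sum_power2_less_if_precedes:
  assumes fin: "finite V" and inj: "inj_on \<sigma> V" and sub: "Z \<subseteq> V" "Y \<subseteq> V"
    and prec: "precedes V \<sigma> Z Y"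
  shows "(\<Sum>v\<in>Y. 2 ^ \<sigma> v) < (\<Sum>v\<in>Z. 2 ^ \<sigma> v :: nat)"
proof -
  obtain z where z: "z \<in> Z" "z \<notin> Y" and agree: "\<And>v. v \<in> V \<Longrightarrow> \<sigma> z < \<sigma> v \<Longrightarrow> v \<in> Z \<longleftrightarrow> v \<in> Y"
    using prec by (auto simp: precedes_def)
  define C where "C = {v \<in> Y. \<sigma> z < \<sigma> v}"
  have finYZ: "finite Y" "finite Z" using fin sub finite_subset by auto
  have C: "C \<subseteq> Y" "insert z C \<subseteq> Z" "z \<notin> C" using z agree sub unfolding C_def by blast+
  have low: "\<sigma> v < \<sigma> z" if "v \<in> Y - C" for v
  proof -
    have v: "v \<in> Y" "\<not> \<sigma> z < \<sigma> v" using that by (auto simp: C_def)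
    have "v \<noteq> z" "v \<in> V" "z \<in> V" using v z sub by auto
    then have "\<sigma> v \<noteq> \<sigma> z" using inj by (meson inj_onD)
    with v show ?thesis by simp
  qed
  have "(\<Sum>v\<in>Y - C. 2 ^ \<sigma> v) = (\<Sum>i\<in>\<sigma> ` (Y - C). 2 ^ i :: nat)"
    using inj sub by (subst sum.reindex) (auto intro: inj_on_subset)
  also have "\<dots> \<le> (\<Sum>i\<in>{0..<\<sigma> z}. 2 ^ i)"
    using low by (intro sum_mono2) auto
  also have "\<dots> < 2 ^ \<sigma> z"
    by (simp add: sum_power2)
  finally have "(\<Sum>v\<in>Y. 2 ^ \<sigma> v) < 2 ^ \<sigma> z + (\<Sum>v\<in>C. 2 ^ \<sigma> v :: nat)"
    using sum.subset_diff[OF C(1) finYZ(1), of "\<lambda>v. 2 ^ \<sigma> v :: nat"] by simp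
  also have "\<dots> = (\<Sum>v\<in>insert z C. 2 ^ \<sigma> v)"
    using C finYZ finite_subset by (subst sum.insert) auto
  also have "\<dots> \<le> (\<Sum>v\<in>Z. 2 ^ \<sigma> v)"
    using C finYZ by (intro sum_mono2) auto
  finally show ?thesis .
qed

lemma precedes_total:
  assumes fin: "finite V" and inj: "inj_on \<sigma> V" and sub: "Z \<subseteq> V" "Y \<subseteq> V" and ne: "Z \<noteq> Y"
  shows "precedes V \<sigma> Z Y \<or> precedes V \<sigma> Y Z"
proof -
  let ?S = "(Z - Y) \<union> (Y - Z)"
  have "?S \<subseteq> V" using sub by blast
  then have "finite ?S" using fin finite_subset by blast
  have "?S \<noteq> {}" using ne by blast
  with \<open>finite ?S\<close> have "Max (\<sigma> ` ?S) \<in> \<sigma> ` ?S" by (intro Max_in) auto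
  then obtain m where m: "m \<in> ?S" "\<sigma> m = Max (\<sigma> ` ?S)" by (metis imageE)
  have "v \<notin> ?S" if "\<sigma> m < \<sigma> v" for v
    using that m(2) \<open>finite ?S\<close> Max_ge[of "\<sigma> ` ?S" "\<sigma> v"] by (metis finite_imageI imageI leD)
  then have "\<forall>v. \<sigma> m < \<sigma> v \<longrightarrow> (v \<in> Z \<longleftrightarrow> v \<in> Y)" by auto
  with m(1) show ?thesis unfolding precedes_def by blast
qed

lemma exists_list_ordered_by_precedes:
  assumes fin: "finite V" and inj: "inj_on \<sigma> V" and sub: "\<And>M. M \<in> \<M> \<Longrightarrow> M \<subseteq> V"
  obtains Ms where "set Ms = \<M>"
    "\<And>i j. j < i \<Longrightarrow> i < length Ms \<Longrightarrow> precedes V \<sigma> (Ms ! j) (Ms ! i)"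
    "\<And>i M. i < length Ms \<Longrightarrow> M \<in> \<M> \<Longrightarrow> precedes V \<sigma> M (Ms ! i) \<Longrightarrow> \<exists>l<i. Ms ! l = M"
proof -
  define weight where "weight M = (\<Sum>v\<in>M. 2 ^ \<sigma> v :: nat)" for M
  have less: "weight N < weight M" if "precedes V \<sigma> M N" "M \<in> \<M>" "N \<in> \<M>" for M N
    using sum_power2_less_if_precedes[OF fin inj _ _ that(1)] that sub by (simp add: weight_def)
  have "finite \<M>" using fin sub by (meson PowI finite_Pow_iff finite_subset subsetI)
  then obtain xs where xs: "set xs = \<M>" "distinct xs" using finite_distinct_list by blast
  define Ms where "Ms = rev (sort_key weight xs)"
  have set: "set Ms = \<M>" and dist: "distinct Ms"
    using xs by (simp_all add: Ms_def)
  have in_M: "Ms ! i \<in> \<M>" if "i < length Ms" for i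
    using that set nth_mem by blast
  have "sorted (rev (map weight Ms))"
    by (simp add: Ms_def rev_map[symmetric])
  then have mono: "weight (Ms ! i) \<le> weight (Ms ! j)" if "j \<le> i" "i < length Ms" for i j
    using that sorted_rev_nth_mono[of "map weight Ms" j i] by simp
  show ?thesis
  proof
    show "set Ms = \<M>" by (rule set)
    fix i j assume ij: "j < i" "i < length Ms"
    then have "Ms ! j \<noteq> Ms ! i" using dist nth_eq_iff_index_eq by fastforce
    moreover have "\<not> precedes V \<sigma> (Ms ! i) (Ms ! j)"
      using mono[of j i] ij less[of "Ms ! i" "Ms ! j"] in_M by fastforce
    moreover have "Ms ! j \<subseteq> V" "Ms ! i \<subseteq> V"
      using ij in_M sub by simp_all
    ultimately show "precedes V \<sigma> (Ms ! j) (Ms ! i)"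
      using precedes_total[OF fin inj] by blast
  next
    fix i M assume i: "i < length Ms" and M: "M \<in> \<M>" "precedes V \<sigma> M (Ms ! i)"
    from M set obtain l where l: "l < length Ms" "Ms ! l = M" by (metis in_set_conv_nth)
    have "\<not> i \<le> l" using mono[of i l] l less[OF M(2,1)] in_M[OF i] by auto
    with l show "\<exists>l<i. Ms ! l = M" by (intro exI[of _ l]) simp
  qed
qed

section \<open>Matchings of paths in a broom\<close>

text \<open>
  A broom reduced to what the combinatorics needs: the handle vertices \<open>x 0, \<dots>, x h\<close> and the
  depth \<open>d\<close>. The handle vertices are those with \<open>v = x (d v)\<close>; a leaf off the handle at depth
  \<open>j + 1\<close> is attached to \<open>x j\<close>.
\<close>

locale broom =
  fixes V :: "'v set" and x :: "nat \<Rightarrow> 'v" and d :: "'v \<Rightarrow> nat" and h t :: nat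
  assumes finite_V: "finite V"
    and handle_in_V: "i \<le> h \<Longrightarrow> x i \<in> V"
    and depth_handle: "i \<le> h \<Longrightarrow> d (x i) = i"
    and depth_le: "v \<in> V \<Longrightarrow> d v \<le> h"
    and two_le_t: "2 \<le> t"
begin

definition ends :: "'v set" where
  "ends = {v \<in> V. t \<le> d v + 1}"

text \<open>
  This is the vertex set of the \<open>t\<close>-path ending in \<open>v\<close> only if \<open>v\<close> is in \<open>ends\<close>; for other vertices the
  truncated subtraction makes the path shorter.
\<close>

definition path_to :: "'v \<Rightarrow> 'v set" where
  "path_to v = insert v (x ` {d v + 1 - t..<d v})"

definition end_matching :: "'v set \<Rightarrow> bool" where
  "end_matching Y \<longleftrightarrow> Y \<subseteq> ends \<and> (\<forall>u\<in>Y. \<forall>v\<in>Y. u \<noteq> v \<longrightarrow> path_to u \<inter> path_to v = {})"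

abbreviation support :: "'v set \<Rightarrow> 'v set" where
  "support Y \<equiv> \<Union> (path_to ` Y)"

definition on_handle :: "'v \<Rightarrow> bool" where
  "on_handle v \<longleftrightarrow> v = x (d v)"

lemma finite_ends: "finite ends"
  using finite_V by (simp add: ends_def)

lemma path_to_subset_V: "v \<in> ends \<Longrightarrow> path_to v \<subseteq> V"
  using depth_le[of v] handle_in_V by (auto simp: ends_def path_to_def)

lemma handle_in_ends: "i \<le> h \<Longrightarrow> t \<le> i + 1 \<Longrightarrow> x i \<in> ends"
  using handle_in_V depth_handle by (simp add: ends_def)

lemma handle_in_path_to_iff:
  assumes "v \<in> ends" "i \<le> h"
  shows "x i \<in> path_to v \<longleftrightarrow> (d v + 1 \<le> i + t \<and> i < d v) \<or> (i = d v \<and> on_handle v)"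
proof -
  have "x i = x j \<longleftrightarrow> i = j" if "j < d v" for j
    using that assms depth_le[of v] depth_handle by (metis ends_def le_trans less_imp_le mem_Collect_eq)
  then have "x i \<in> x ` {d v + 1 - t..<d v} \<longleftrightarrow> i \<in> {d v + 1 - t..<d v}"
    by (metis (no_types, lifting) atLeastLessThan_iff image_iff)
  then have "x i \<in> x ` {d v + 1 - t..<d v} \<longleftrightarrow> d v + 1 \<le> i + t \<and> i < d v"
    by auto
  moreover have "x i = v \<longleftrightarrow> i = d v \<and> on_handle v"
    using assms depth_handle by (auto simp: on_handle_def)
  ultimately show ?thesis
    by (auto simp: path_to_def)
qed

lemma path_to_cases:
  assumes "u \<in> path_to v" "v \<in> ends"
  obtains "u = v" | i where "u = x i" "i < d v" "i \<le> h" "d v + 1 \<le> i + t"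
  using assms depth_le[of v] by (fastforce simp: path_to_def ends_def)

text \<open>
  The upper path occupies the handle down to depth \<open>d u\<close> if \<open>u\<close> is on the handle, and only down to
  \<open>d u - 1\<close> otherwise; the lower path starts at depth \<open>d v + 1 - t\<close>.
\<close>

lemma disjoint_path_to_iff:
  assumes "u \<in> ends" "v \<in> ends" "u \<noteq> v" "d u \<le> d v"
  shows "path_to u \<inter> path_to v = {} \<longleftrightarrow> d u + t + (if on_handle u then 1 else 0) \<le> d v + 1"
    (is "?L \<longleftrightarrow> ?R")
proof
  have uv: "t \<le> d u + 1" "t \<le> d v + 1" "d u \<le> h" "d v \<le> h"
    using assms depth_le by (auto simp: ends_def)
  show ?R if ?L
  proof (rule ccontr)
    assume neg: "\<not> ?R"
    have "\<exists>i\<le>h. x i \<in> path_to u \<and> x i \<in> path_to v"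
    proof (cases "d u = d v")
      case True
      then show ?thesis
        using uv two_le_t assms by (intro exI[of _ "d v - 1"]) (auto simp: handle_in_path_to_iff)
    next
      case False
      then show ?thesis
        using neg uv two_le_t assms
        by (intro exI[of _ "if on_handle u then d u else d u - 1"])
          (auto simp: handle_in_path_to_iff split: if_splits)
    qed
    with that show False by blast
  qed
  show ?L if ?R
  proof (rule ccontr)
    assume "\<not> ?L"
    then obtain w where w: "w \<in> path_to u" "w \<in> path_to v" by blast
    have lt: "d u < d v"
      using that two_le_t by linarith
    from w(1) assms(1) show False
    proof (cases rule: path_to_cases)
      case 1
      with w(2) assms(2) show False
      proof (cases rule: path_to_cases)
        case (2 i)
        with 1 have "d u = i" "on_handle u" using depth_handle by (auto simp: on_handle_def)
        with 2 that show False by simp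
      qed (use assms 1 in simp)
    next
      case (2 i)
      with w(2) assms(2) lt uv that show False
        by (auto simp: handle_in_path_to_iff split: if_splits)
    qed
  qed
qed

lemma path_to_inj: "inj_on path_to ends"
proof (rule inj_onI)
  have *: "u = v" if "u \<in> ends" "v \<in> ends" "path_to u = path_to v" "d u \<le> d v" for u v
  proof (rule ccontr)
    assume "u \<noteq> v"
    have "v \<in> path_to u" using that(3) by (auto simp: path_to_def)
    then show False
      using that(1) by (cases rule: path_to_cases) (use \<open>u \<noteq> v\<close> that depth_handle in auto)
  qed
  show "u = v" if "u \<in> ends" "v \<in> ends" "path_to u = path_to v" for u v
    using *[of u v] *[of v u] that by (cases "d u \<le> d v") auto
qed

lemma card_path_to: "v \<in> ends \<Longrightarrow> card (path_to v) = t"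
proof -
  assume v: "v \<in> ends"
  then have le: "t \<le> d v + 1" "d v \<le> h"
    using depth_le by (auto simp: ends_def)
  have "inj_on x {d v + 1 - t..<d v}"
    using le depth_handle by (intro inj_on_inverseI[of _ d]) auto
  moreover have "v \<notin> x ` {d v + 1 - t..<d v}"
  proof
    assume "v \<in> x ` {d v + 1 - t..<d v}"
    then obtain i where "v = x i" "i < d v" by auto
    with le depth_handle[of i] show False by simp
  qed
  ultimately show ?thesis
    using le two_le_t by (simp add: path_to_def card_image)
qed

lemma finite_path_to: "finite (path_to v)"
  by (simp add: path_to_def)

lemma end_matching_finite: "end_matching Y \<Longrightarrow> finite Y"
  using finite_ends finite_subset by (auto simp: end_matching_def)

lemma card_support:
  assumes "end_matching Y"
  shows "card (support Y) = card Y * t"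
proof -
  have "card (support Y) = (\<Sum>v\<in>Y. card (path_to v))"
    using assms finite_path_to end_matching_finite
    by (intro card_UN_disjoint) (auto simp: end_matching_def)
  also have "\<dots> = (\<Sum>v\<in>Y. t)"
    using assms card_path_to by (intro sum.cong) (auto simp: end_matching_def)
  finally show ?thesis by simp
qed

text \<open>
  Replacing one path by another that needs only one additional vertex \<open>a\<close> cannot create
  overlaps as long as \<open>a\<close> was not covered before.
\<close>

lemma end_matching_exchange:
  assumes Y: "end_matching Y" and y: "y \<in> Y" and y': "y' \<in> ends"
    and a: "a \<in> path_to y'" "a \<notin> support Y" "path_to y' \<subseteq> insert a (path_to y)"
  shows "end_matching (insert y' (Y - {y}))" "y' \<notin> Y"
    "card (insert y' (Y - {y})) = card Y"
    "support (insert y' (Y - {y})) - support Y = {a}"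
proof -
  show y'Y: "y' \<notin> Y" using a by blast
  have "path_to y' \<inter> path_to v = {}" if "v \<in> Y - {y}" for v
    using that Y y a unfolding end_matching_def by blast
  with Y y' show "end_matching (insert y' (Y - {y}))"
    unfolding end_matching_def by blast
  show "card (insert y' (Y - {y})) = card Y"
    using y y'Y end_matching_finite[OF Y] card_Suc_Diff1[of Y y] by (simp del: card_Diff_singleton)
  show "support (insert y' (Y - {y})) - support Y = {a}"
    using a y by auto
qed

section \<open>The exchange property\<close>

text \<open>
  Lexicographically first come small depths, and within a depth the leaves come before the handle
  vertex. The second rule matters when two ends of equal depth are exchanged: the incoming one
  is then a leaf, which no other path can contain.
\<close>

definition priority :: "'v \<Rightarrow> nat" where
  "priority v = 2 * (h - d v) + (if on_handle v then 0 else 1)"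

text \<open>
  This is what the shift of the path to \<open>y\<close> towards the root requires: the vertex it gains,
  \<open>x (d y - t)\<close>, lies on the path to the new end \<open>z\<close>. The condition is restricted to the critical
  case that \<open>Y\<close> and \<open>z\<close> together still form a matching, with no end at a depth strictly
  between those of \<open>z\<close> and \<open>y\<close>; if the paths to \<open>z\<close> and \<open>y\<close> meet, it holds automatically.
\<close>

definition exchangeable :: "nat \<Rightarrow> bool" where
  "exchangeable k \<longleftrightarrow>
     (\<forall>Y. \<forall>y\<in>Y. \<forall>z\<in>ends. end_matching Y \<and> card Y = k \<and> z \<notin> Y \<and> end_matching (insert z Y) \<and> d z < d y \<and>
       (\<forall>v\<in>Y. d v \<le> d z \<or> d y \<le> d v) \<longrightarrow> x (d y - t) \<in> path_to z)"

text \<open>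
  Among the ends of \<open>Y\<close> after the first difference \<open>z\<close>, let \<open>y\<close> be the first. Everything of \<open>Y\<close> before
  \<open>z\<close> also belongs to \<open>Z\<close> and so avoids the path to \<open>z\<close>; everything else is at least as
  deep as \<open>y\<close>. At equal depths \<open>y\<close> is replaced by \<open>z\<close>, otherwise by \<open>x (d y - 1)\<close>. Both
  replacements gain one vertex only, and it lies on the path to \<open>z\<close>.
\<close>

lemma end_matching_exchange_towards:
  assumes inj: "inj_on \<sigma> V" and mono: "\<forall>u\<in>V. \<forall>v\<in>V. priority u < priority v \<longrightarrow> \<sigma> u < \<sigma> v"
    and k: "exchangeable (card Y)" and Y: "end_matching Y" and Z: "end_matching Z"
    and card: "card Z = card Y" and prec: "precedes V \<sigma> Z Y"
  shows "\<exists>Y'. end_matching Y' \<and> card Y' = card Y \<and> precedes V \<sigma> Y' Y \<and>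
    (\<exists>a\<in>support Z. support Y' - support Y = {a})"
proof -
  obtain z where z: "z \<in> Z" "z \<notin> Y" and agree: "\<And>v. v \<in> V \<Longrightarrow> \<sigma> z < \<sigma> v \<Longrightarrow> v \<in> Z \<longleftrightarrow> v \<in> Y"
    using prec by (auto simp: precedes_def)
  have ends: "Y \<subseteq> ends" "Z \<subseteq> ends" and V: "ends \<subseteq> V" and fin: "finite Y" "finite Z"
    using Y Z end_matching_finite by (auto simp: end_matching_def ends_def)
  \<comment> \<open>The common initial part of both matchings.\<close>
  define C where "C = {v \<in> Y. \<sigma> z < \<sigma> v}"
  have CZ: "C \<subseteq> Z - {z}"
    using agree ends V by (auto simp: C_def)
  have C_disjoint: "path_to z \<inter> path_to v = {}" if "v \<in> C" for v
  proof -
    have "v \<in> Z" "z \<noteq> v" using that CZ by auto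
    then show ?thesis using Z z(1) unfolding end_matching_def by blast
  qed
  have "card C < card Y"
    using card_mono[OF _ CZ] fin z card card_gt_0_iff[of Z] by auto
  then have "Y - C \<noteq> {}"
    using fin by (metis Diff_eq_empty_iff C_def card_mono leD finite_subset[of C Y] mem_Collect_eq subsetI)
  then have "Max (\<sigma> ` (Y - C)) \<in> \<sigma> ` (Y - C)"
    using fin by (intro Max_in) auto
  then obtain y where "y \<in> Y - C" and y_Max: "\<sigma> y = Max (\<sigma> ` (Y - C))"
    by auto
  then have y: "y \<in> Y" "\<not> \<sigma> z < \<sigma> y"
    by (auto simp: C_def)
  have ymax: "\<sigma> v \<le> \<sigma> y" if "v \<in> Y - C" for v
    using that fin by (simp add: y_Max)
  have exchange: ?thesis if "\<sigma> y < \<sigma> y'" "y' \<in> ends" "a \<in> path_to y'" "a \<notin> support Y" "a \<in> support Z"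
    "path_to y' \<subseteq> insert a (path_to y)" for y' a
  proof (intro exI conjI bexI)
    note ex = end_matching_exchange[OF Y y(1) that(2,3,4,6)]
    show "end_matching (insert y' (Y - {y}))" "card (insert y' (Y - {y})) = card Y"
      "support (insert y' (Y - {y})) - support Y = {a}" by (fact ex)+
    show "precedes V \<sigma> (insert y' (Y - {y})) Y"
      unfolding precedes_def using that(1) ex(2) by (intro bexI[of _ y']) auto
    show "a \<in> support Z" by fact
  qed
  have zV: "z \<in> ends" and yV: "y \<in> ends" and zny: "z \<noteq> y" using z y ends by auto
  have dle: "d z \<le> h" "d y \<le> h" "t \<le> d z + 1" "t \<le> d y + 1"
    using zV yV depth_le by (auto simp: ends_def)
  have prio_anti: "priority v \<le> priority u" if "\<sigma> v \<le> \<sigma> u" "u \<in> V" "v \<in> V" for u v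
    using mono that by (meson leD leI)
  have depth_mono: "d u \<le> d v" if "\<sigma> v \<le> \<sigma> u" "u \<in> V" "v \<in> V" for u v
    using prio_anti[OF that] depth_le[OF that(2)] depth_le[OF that(3)]
    by (auto simp: priority_def split: if_splits)
  have zy: "d z \<le> d y" "priority y \<le> priority z"
    using depth_mono[of y z] prio_anti[of y z] y zV yV V by auto
  have C_le: "d v \<le> d z" if "v \<in> C" for v
    using that depth_mono[of z v] zV ends V by (auto simp: C_def)
  have D_ge: "d y \<le> d v" if "v \<in> Y - C" for v
    using that depth_mono[of v y] ymax[OF that] yV ends V by blast
  show ?thesis
  proof (cases "d z = d y")
    case True
    have off: "\<not> on_handle z"
    proof
      assume "on_handle z"
      moreover from this have "on_handle y"
        using zy(2) True by (auto simp: priority_def split: if_splits)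
      ultimately show False using True z y by (simp add: on_handle_def)
    qed
    have z_notin: "z \<notin> path_to v" if "v \<in> Y" for v
    proof
      assume "z \<in> path_to v"
      moreover have "v \<in> ends" using that ends by auto
      ultimately show False
        by (cases rule: path_to_cases) (use off z that depth_handle in \<open>auto simp: on_handle_def\<close>)
    qed
    have z_ins: "path_to z \<subseteq> insert z (path_to y)" "z \<in> path_to z"
      using True by (auto simp: path_to_def)
    have z_sup: "z \<notin> support Y" "z \<in> support Z" using z_notin z by (auto simp: path_to_def)
    have "\<sigma> y \<noteq> \<sigma> z"
      using inj y z zV yV V by (auto dest: inj_onD)
    then have "\<sigma> y < \<sigma> z"
      using y(2) by simp
    from exchange[OF this zV z_ins(2) z_sup z_ins(1)] show ?thesis .
  next
    case False
    then have lt: "d z < d y" using zy by simp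
    define a where "a = x (d y - t)"
    define y' where "y' = x (d y - 1)"
    have y': "y' \<in> ends" "d y' = d y - 1" "on_handle y'"
      using dle lt handle_in_ends[of "d y - 1"] depth_handle[of "d y - 1"]
      by (auto simp: y'_def on_handle_def)
    have aZ: "a \<in> path_to z"
    proof (cases "path_to z \<inter> path_to y = {}")
      case True
      then have sep: "d z + t + (if on_handle z then 1 else 0) \<le> d y + 1"
        using disjoint_path_to_iff[OF zV yV zny] lt by auto
      have "path_to z \<inter> path_to v = {}" if "v \<in> Y" for v
      proof (cases "v \<in> C")
        case True
        then show ?thesis by (rule C_disjoint)
      next
        case False
        then have "d y \<le> d v" using D_ge that by simp
        then show ?thesis
          using disjoint_path_to_iff[OF zV, of v] sep lt that z ends by auto
      qed
      then have "end_matching (insert z Y)"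
        using Y zV unfolding end_matching_def by blast
      moreover have "\<forall>v\<in>Y. d v \<le> d z \<or> d y \<le> d v"
        using C_le D_ge by blast
      ultimately show ?thesis
        using k zV Y y z lt by (auto simp: exchangeable_def a_def)
    next
      case False
      then have "d y + 1 < d z + t + (if on_handle z then 1 else 0)"
        using disjoint_path_to_iff[OF zV yV zny] lt by auto
      then show ?thesis
        using dle lt zV by (auto simp: a_def handle_in_path_to_iff split: if_splits)
    qed
    have aY: "a \<notin> path_to v" if "v \<in> Y" for v
    proof (cases "v \<in> C")
      case True
      then show ?thesis using C_disjoint aZ by blast
    next
      case False
      then have "d y \<le> d v" "v \<in> ends" using D_ge that ends by auto
      then show ?thesis
        using lt dle two_le_t by (auto simp: a_def handle_in_path_to_iff)
    qed
    have ay': "a \<in> path_to y'"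
      using y' lt dle two_le_t by (auto simp: a_def handle_in_path_to_iff)
    have y'_sub: "path_to y' \<subseteq> insert a (path_to y)"
    proof
      fix w assume "w \<in> path_to y'"
      from this y'(1) have "\<exists>i. w = x i \<and> i < d y \<and> d y \<le> i + t"
      proof (cases rule: path_to_cases)
        case 1
        then show ?thesis using lt two_le_t by (intro exI[of _ "d y - 1"]) (auto simp: y'_def)
      next
        case (2 i)
        then show ?thesis using y'(2) lt by (intro exI[of _ i]) auto
      qed
      then obtain i where "w = x i" "i < d y" "d y \<le> i + t"
        by blast
      then show "w \<in> insert a (path_to y)"
        using yV dle lt by (cases "i = d y - t") (auto simp: a_def handle_in_path_to_iff)
    qed
    have "\<sigma> y < \<sigma> y'"
      using y'(1,2) lt dle yV V by (intro mono[rule_format]) (auto simp: priority_def)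
    moreover have "a \<notin> support Y" "a \<in> support Z" using aY aZ z by auto
    ultimately show ?thesis
      using exchange y'(1) ay' y'_sub by blast
  qed
qed

lemma exchangeable_if_maximal:
  assumes "\<And>Y. end_matching Y \<Longrightarrow> card Y \<le> k"
  shows "exchangeable k"
proof -
  have "\<not> end_matching (insert z Y)" if "card Y = k" "z \<notin> Y" "end_matching Y" for z Y
    using assms[of "insert z Y"] that end_matching_finite[of Y] by auto
  then show ?thesis by (auto simp: exchangeable_def)
qed

text \<open>
  If the vertex \<open>x (d y - t)\<close> is missing from the path to \<open>z\<close>, then it is missing from all \<open>k + 1\<close>
  disjoint paths, which therefore fit into the remaining \<open>h\<close> vertices.
\<close>

lemma exchangeable_path:
  assumes V: "V = x ` {..h}" and k: "h < Suc k * t"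
  shows "exchangeable k"
proof -
  have "x (d y - t) \<in> path_to z"
    if Y: "card Y = k" "z \<notin> Y" "end_matching (insert z Y)" and y: "y \<in> Y" "d z < d y"
      and split: "\<forall>v\<in>Y. d v \<le> d z \<or> d y \<le> d v" for Y y z
  proof (rule ccontr)
    assume a: "x (d y - t) \<notin> path_to z"
    have ends: "Y \<subseteq> ends" "z \<in> ends" "finite Y" using Y(3) end_matching_finite by (auto simp: end_matching_def)
    have hd: "on_handle v" if "v \<in> ends" for v
    proof -
      from that have "v \<in> V" by (simp add: ends_def)
      with V obtain i where "i \<le> h" "v = x i" by auto
      then show ?thesis using depth_handle by (simp add: on_handle_def)
    qed
    have dle: "d y \<le> h" "t \<le> d z + 1" "t \<le> d y + 1" using y ends depth_le by (auto simp: ends_def)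
    have far: "d z < d y - t"
      using a y dle ends hd[OF ends(2)] by (simp add: handle_in_path_to_iff)
    have "x (d y - t) \<notin> path_to v" if "v \<in> insert z Y" for v
    proof (cases "v = z")
      case False
      with that ends split have "v \<in> ends" "d v \<le> d z \<or> d y \<le> d v" by auto
      then show ?thesis
        using far dle two_le_t by (auto simp: handle_in_path_to_iff)
    qed (use a in simp)
    then have "support (insert z Y) \<subseteq> V - {x (d y - t)}"
      using path_to_subset_V ends by blast
    moreover have "card (V - {x (d y - t)}) \<le> h"
      using V dle card_image_le[of "{..h}" x] by (simp add: handle_in_V)
    ultimately have "card (support (insert z Y)) \<le> h"
      using finite_V card_mono[of "V - {x (d y - t)}"] by (meson finite_Diff le_trans)
    then have "Suc k * t \<le> h"
      using card_support[OF Y(3)] Y ends by simp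
    with k show False by simp
  qed
  then show ?thesis unfolding exchangeable_def by blast
qed


text \<open>
  A refinement of the priority that breaks ties between leaves of one depth arbitrarily.
\<close>

lemma exists_priority_injection:
  obtains \<sigma> :: "'v \<Rightarrow> nat" where "inj_on \<sigma> V"
    "\<forall>u\<in>V. \<forall>v\<in>V. priority u < priority v \<longrightarrow> \<sigma> u < \<sigma> v"
proof -
  obtain f :: "'v \<Rightarrow> nat" and n where f: "f ` V = {i. i < n}" "inj_on f V"
    using finite_imp_inj_to_nat_seg[OF finite_V] by auto
  have fn: "f v < n" if "v \<in> V" for v using f that by auto
  show ?thesis
  proof
    have less: "priority u * n + f u < priority v * n + f v"
      if "u \<in> V" "priority u < priority v" for u v
    proof -
      have "priority u * n + f u < Suc (priority u) * n" using fn[OF that(1)] by simp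
      also have "\<dots> \<le> priority v * n" using that(2) by (intro mult_le_mono1) simp
      finally show ?thesis by simp
    qed
    then show "\<forall>u\<in>V. \<forall>v\<in>V. priority u < priority v \<longrightarrow>
        (\<lambda>v. priority v * n + f v) u < (\<lambda>v. priority v * n + f v) v"
      by simp
    show "inj_on (\<lambda>v. priority v * n + f v) V"
    proof (rule inj_onI)
      fix u v assume uv: "u \<in> V" "v \<in> V" "priority u * n + f u = priority v * n + f v"
      then have "priority u = priority v" using less[of u v] less[of v u] by (metis less_irrefl linorder_neqE_nat)
      with uv f show "u = v" by (simp add: inj_on_eq_iff)
    qed
  qed
qed

lemma exists_linear_quotient_order:
  assumes "exchangeable k"
  obtains Us where "set Us = support ` {Y. end_matching Y \<and> card Y = k}"
    "\<And>i j. j < i \<Longrightarrow> i < length Us \<Longrightarrow> \<exists>l<i. \<exists>v. Us ! l - Us ! i = {v} \<and> v \<in> Us ! j"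
proof -
  obtain \<sigma> :: "'v \<Rightarrow> nat" where \<sigma>: "inj_on \<sigma> V"
      "\<forall>u\<in>V. \<forall>v\<in>V. priority u < priority v \<longrightarrow> \<sigma> u < \<sigma> v"
    using exists_priority_injection by blast
  let ?M = "{Y. end_matching Y \<and> card Y = k}"
  have sub: "Y \<subseteq> V" if "Y \<in> ?M" for Y
    using that by (auto simp: end_matching_def ends_def)
  obtain Ms where Ms: "set Ms = ?M"
    "\<And>i j. j < i \<Longrightarrow> i < length Ms \<Longrightarrow> precedes V \<sigma> (Ms ! j) (Ms ! i)"
    "\<And>i M. i < length Ms \<Longrightarrow> M \<in> ?M \<Longrightarrow> precedes V \<sigma> M (Ms ! i) \<Longrightarrow> \<exists>l<i. Ms ! l = M"
    using exists_list_ordered_by_precedes[OF finite_V \<sigma>(1) sub] by blast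
  show ?thesis
  proof
    show "set (map support Ms) = support ` ?M" using Ms(1) by simp
    fix i j assume ij: "j < i" "i < length (map support Ms)"
    then have "Ms ! i \<in> ?M" "Ms ! j \<in> ?M"
      using Ms(1) nth_mem[of i Ms] nth_mem[of j Ms] by auto
    then have in_M: "end_matching (Ms ! i)" "end_matching (Ms ! j)" "card (Ms ! i) = k" "card (Ms ! j) = card (Ms ! i)"
      by simp_all
    have "precedes V \<sigma> (Ms ! j) (Ms ! i)" using Ms(2) ij by simp
    then obtain Y' a where Y': "end_matching Y'" "card Y' = k" "precedes V \<sigma> Y' (Ms ! i)"
      and a: "a \<in> support (Ms ! j)" "support Y' - support (Ms ! i) = {a}"
      using end_matching_exchange_towards[OF \<sigma> _ in_M(1,2,4)] assms unfolding in_M(3) by blast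
    obtain l where l: "l < i" "Ms ! l = Y'"
      using Ms(3)[of i Y'] ij Y' by auto
    show "\<exists>l<i. \<exists>v. map support Ms ! l - map support Ms ! i = {v} \<and> v \<in> map support Ms ! j"
      using l ij a by (intro exI[of _ l] conjI exI[of _ a]) simp_all
  qed
qed

lemma end_matching_handle:
  assumes D: "\<And>i. i \<in> D \<Longrightarrow> i \<le> h \<and> t \<le> i + 1" and far: "\<And>i j. i \<in> D \<Longrightarrow> j \<in> D \<Longrightarrow> i < j \<Longrightarrow> i + t \<le> j"
  shows "end_matching (x ` D)"
proof -
  have *: "path_to (x i) \<inter> path_to (x j) = {}" if "i \<in> D" "j \<in> D" "i < j" for i j
  proof -
    have "x i \<in> ends" "x j \<in> ends" using D that handle_in_ends by auto
    moreover have "d (x i) = i" "d (x j) = j" using D that depth_handle by auto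
    moreover from this have "x i \<noteq> x j" "on_handle (x i)" using that by (auto simp: on_handle_def)
    ultimately show ?thesis
      using disjoint_path_to_iff[of "x i" "x j"] far[OF that] by simp
  qed
  have "path_to (x i) \<inter> path_to (x j) = {}" if "i \<in> D" "j \<in> D" "x i \<noteq> x j" for i j
    using *[of i j] *[of j i] that by (cases i j rule: linorder_cases) auto
  moreover have "x ` D \<subseteq> ends" using D handle_in_ends by auto
  ultimately show ?thesis unfolding end_matching_def by blast
qed

text \<open>
  The path to \<open>w = x (t - 1)\<close> covers the depths \<open>0, \<dots>, t - 1\<close>; depth \<open>t\<close> is skipped, and the paths to
  \<open>x (2 t), x (3 t), \<dots>\<close> follow without further breaks. Because of the skipped vertex, a path
  inside the union of the first path and another one must be one of these two.
\<close>

lemma exists_spread_end_matching: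
  assumes V: "V = x ` {..h}" and k: "Suc k * t \<le> h"
  obtains W w where "end_matching W" "card W = Suc k" "w \<in> W"
    "\<And>v u. v \<in> W - {w} \<Longrightarrow> u \<in> ends \<Longrightarrow> path_to u \<subseteq> path_to w \<union> path_to v \<Longrightarrow> u = w \<or> u = v"
proof -
  define D where "D = insert (t - 1) ((\<lambda>j. j * t) ` {2..Suc k})"
  have D_cases: "i = t - 1 \<or> (\<exists>j. i = j * t \<and> 2 \<le> j \<and> j \<le> Suc k)" if "i \<in> D" for i
    using that by (auto simp: D_def)
  have mult_far: "i * t + t \<le> j * t" if "i < j" for i j
    using mult_le_mono1[of "Suc i" j t] that by simp
  have D: "i \<le> h \<and> t \<le> i + 1" if "i \<in> D" for i
    using D_cases[OF that]
  proof (elim disjE exE conjE)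
    fix j assume "i = j * t" "2 \<le> j" "j \<le> Suc k"
    then show ?thesis using k mult_le_mono1[of j "Suc k" t] mult_le_mono1[of 1 j t] by linarith
  qed (use k two_le_t in auto)
  have far: "i + t \<le> j" if "i \<in> D" "j \<in> D" "i < j" for i j
    using D_cases[OF that(1)] D_cases[OF that(2)]
  proof (elim disjE exE conjE)
    fix j' assume "i = t - 1" "j = j' * t" "2 \<le> j'"
    then show ?thesis using mult_le_mono1[of 2 j' t] two_le_t by linarith
  next
    fix i' assume "j = t - 1" "i = i' * t" "2 \<le> i'"
    then show ?thesis using that(3) mult_le_mono1[of 2 i' t] two_le_t by linarith
  next
    fix i' j' assume "i = i' * t" "j = j' * t"
    then show ?thesis using that(3) mult_far[of i' j'] by auto
  qed (use that(3) in simp)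
  have inj: "inj_on x D"
    using D depth_handle by (intro inj_on_inverseI[of _ d]) auto
  have "t - 1 \<notin> (\<lambda>j. j * t) ` {2..Suc k}"
  proof
    assume "t - 1 \<in> (\<lambda>j. j * t) ` {2..Suc k}"
    then obtain j where "t - 1 = j * t" "j \<in> {2..Suc k}" by (rule imageE)
    then have "2 \<le> j" by simp
    from \<open>t - 1 = j * t\<close> mult_le_mono1[OF this, of t] show False using two_le_t by linarith
  qed
  then have "card D = Suc k"
    using two_le_t by (simp add: D_def card_image inj_on_def)
  show ?thesis
  proof
    show "end_matching (x ` D)" using D far by (rule end_matching_handle)
    show "card (x ` D) = Suc k" using inj \<open>card D = Suc k\<close> by (simp add: card_image)
    show "x (t - 1) \<in> x ` D" by (simp add: D_def)
    fix v u assume v: "v \<in> x ` D - {x (t - 1)}" and u: "u \<in> ends"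
      and sub: "path_to u \<subseteq> path_to (x (t - 1)) \<union> path_to v"
    from v obtain i where i: "v = x i" "i \<in> D" "i \<noteq> t - 1" by auto
    from D_cases[OF i(2)] i(1,3) obtain j where j: "v = x (j * t)" "2 \<le> j" "j \<le> Suc k" by auto
    have jt: "j * t \<le> h" "2 * t \<le> j * t" "t - 1 \<le> h"
      using j k two_le_t mult_le_mono1[of j "Suc k" t] mult_le_mono1[of 2 j t] by linarith+
    from u have "u \<in> V" "t \<le> d u + 1" by (simp_all add: ends_def)
    with V obtain e where e: "u = x e" "e \<le> h" by auto
    then have "d u = e" "t \<le> e + 1" using depth_handle \<open>t \<le> d u + 1\<close> by simp_all
    have handle: "x i \<in> path_to (x n) \<longleftrightarrow> n + 1 \<le> i + t \<and> i \<le> n" if "i \<le> h" "n \<le> h" "t \<le> n + 1" for i n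
      using handle_in_path_to_iff[of "x n" i] handle_in_ends[of n] depth_handle[of n] that two_le_t
      by (auto simp: on_handle_def)
    have covered: "i \<le> t - 1 \<or> j * t + 1 \<le> i + t \<and> i \<le> j * t" if "e + 1 \<le> i + t" "i \<le> e" for i
    proof -
      have "i \<le> h" using that(2) e(2) by simp
      have "x i \<in> path_to u" using that handle[OF \<open>i \<le> h\<close> e(2)] e(1) \<open>t \<le> e + 1\<close> by simp
      with sub have "x i \<in> path_to (x (t - 1)) \<or> x i \<in> path_to (x (j * t))" unfolding j(1) by blast
      moreover have "t \<le> t - 1 + 1" "t \<le> j * t + 1" using jt by linarith+
      ultimately show ?thesis
        using handle[OF \<open>i \<le> h\<close> jt(3)] handle[OF \<open>i \<le> h\<close> jt(1)] by blast
    qed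
    \<comment> \<open>The handle position just before the second path lies in neither path.\<close>
    have gap: "\<not> (e + 1 \<le> j * t - t + t \<and> j * t - t \<le> e)"
    proof
      assume "e + 1 \<le> j * t - t + t \<and> j * t - t \<le> e"
      then have "j * t - t \<le> t - 1 \<or> j * t + 1 \<le> j * t - t + t \<and> j * t - t \<le> j * t"
        by (intro covered) simp_all
      with jt two_le_t show False by linarith
    qed
    have "e \<le> t - 1 \<or> j * t + 1 \<le> e + t \<and> e \<le> j * t"
      using two_le_t by (intro covered) simp_all
    with gap jt \<open>t \<le> e + 1\<close> have "e = t - 1 \<or> e = j * t"
      by linarith
    then show "u = x (t - 1) \<or> u = v" using e(1) j(1) by blast
  qed
qed

end

section \<open>Brooms as directed graphs\<close>

lemma vwalk_arcs_nth:
  assumes "Suc n < length p"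
  shows "(p ! n, p ! Suc n) \<in> set (vwalk_arcs p)"
  using assms
proof (induction p arbitrary: n rule: vwalk_arcs.induct)
  case (3 a b q)
  then show ?case by (cases n) auto
qed auto

lemma vwalk_snoc:
  assumes "p \<noteq> []"
  shows "vwalk (p @ [v]) (with_proj G) \<longleftrightarrow> vwalk p (with_proj G) \<and> v \<in> pverts G \<and> (last p, v) \<in> parcs G"
  using assms set_vwalk_arcs_snoc[of p v] by (auto simp: vwalk_def)

abbreviation underlying :: "'v pair_pre_digraph \<Rightarrow> 'v pair_pre_digraph" where
  "underlying G \<equiv> mk_symmetric (with_proj G)"

lemma arc_underlying: "(u, v) \<in> parcs (underlying G) \<longleftrightarrow> (u, v) \<in> parcs G \<or> (v, u) \<in> parcs G"
proof -
  have "parcs (underlying G) = parcs G \<union> {(v, u). (u, v) \<in> parcs G}"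
    by (auto simp: mk_symmetric_def)
  then show ?thesis by simp
qed

text \<open>
  Closing such a segment by one more edge, or by two edges through a further vertex, gives a cycle
  of the underlying graph; this is how chords and second parents are excluded below.
\<close>

lemma handle_segment:
  assumes xs: "vpath xs (with_proj G)" and ij: "i \<le> j" "j < length xs"
  defines "p \<equiv> take (Suc j - i) (drop i xs)"
  shows "vpath p (with_proj (underlying G))" "length p = Suc j - i" "hd p = xs ! i" "last p = xs ! j"
    "set p \<subseteq> set xs"
proof -
  show len: "length p = Suc j - i" using ij by (simp add: p_def)
  show "hd p = xs ! i" using ij by (simp add: p_def hd_drop_conv_nth)
  have "p \<noteq> []" using len ij by auto
  then show "last p = xs ! j" using len ij by (simp add: last_conv_nth p_def)
  have eq: "xs = take i xs @ p @ drop (Suc j - i) (drop i xs)"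
    unfolding p_def append_take_drop_id ..
  show sub: "set p \<subseteq> set xs" by (metis eq Un_iff set_append subsetI)
  have "set (vwalk_arcs p) \<subseteq> set (vwalk_arcs xs)"
    by (metis eq order_trans set_vwalk_arcs_append1 set_vwalk_arcs_append2)
  moreover have "distinct p" using xs by (simp add: p_def vpath_def)
  ultimately show "vpath p (with_proj (underlying G))"
    using xs sub \<open>p \<noteq> []\<close> by (auto simp: vpath_def vwalk_def arc_underlying)
qed

lemma directed_tree_no_chord:
  assumes G: "directed_tree G" and xs: "vpath xs (with_proj G)"
    and ij: "i < length xs" "j < length xs" and arc: "(xs ! i, xs ! j) \<in> parcs G"
  shows "j = Suc i"
proof -
  have no_cycle: "\<not> (3 \<le> length p \<and> (last p, hd p) \<in> parcs (underlying G))"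
    if "vpath p (with_proj (underlying G))" for p
    using G that by (auto simp: directed_tree_def)
  have antisym: "(v, u) \<notin> parcs G" if "(u, v) \<in> parcs G" for u v
    using G that by (auto simp: directed_tree_def)
  have step: "(xs ! n, xs ! Suc n) \<in> parcs G" if "Suc n < length xs" for n
    using vwalk_arcs_nth[OF that] xs by (auto simp: vpath_def vwalk_def)
  have near: "n \<le> Suc m" if "m < n" "n < length xs" "(xs ! m, xs ! n) \<in> parcs (underlying G)" for m n
  proof (rule ccontr)
    assume "\<not> n \<le> Suc m"
    then have "3 \<le> Suc n - m" by simp
    with that handle_segment[OF xs, of m n] no_cycle[of "take (Suc n - m) (drop m xs)"] show False
      by (simp add: arc_underlying)
  qed
  show ?thesis
  proof (cases i j rule: linorder_cases)
    case less
    then show ?thesis using near[of i j] ij arc by (simp add: arc_underlying)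
  next
    case equal
    then show ?thesis using antisym[OF arc] arc by simp
  next
    case greater
    then have "i = Suc j" using near[of j i] ij arc by (simp add: arc_underlying)
    then show ?thesis using antisym[OF arc] step[of j] ij by simp
  qed
qed

lemma directed_tree_unique_parent:
  assumes G: "directed_tree G" and xs: "vpath xs (with_proj G)" and v: "v \<notin> set xs"
    and ij: "i < length xs" "j < length xs" and arc: "(xs ! i, v) \<in> parcs G" "(xs ! j, v) \<in> parcs G"
  shows "i = j"
proof -
  have no_cycle: "\<not> (3 \<le> length p \<and> (last p, hd p) \<in> parcs (underlying G))"
    if "vpath p (with_proj (underlying G))" for p
    using G that by (auto simp: directed_tree_def)
  have vG: "v \<in> pverts G"
    using G arc pair_wf_digraph.in_arcsD2[of G "xs ! i" v]
    by (auto simp: directed_tree_def pair_digraph_def pair_fin_digraph_def)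
  have *: "\<not> m < n" if "n < length xs" "(xs ! m, v) \<in> parcs G" "(xs ! n, v) \<in> parcs G" for m n
  proof
    assume "m < n"
    define p where "p = take (Suc n - m) (drop m xs)"
    note seg = handle_segment[OF xs less_imp_le[OF \<open>m < n\<close>] that(1), folded p_def]
    have "p \<noteq> []" using seg(2) \<open>m < n\<close> by auto
    have "vpath (p @ [v]) (with_proj (underlying G))"
      using seg vG v that \<open>p \<noteq> []\<close> vwalk_snoc[OF \<open>p \<noteq> []\<close>, of v "underlying G"]
      by (auto simp: vpath_def arc_underlying)
    from no_cycle[OF this] show False
      using seg \<open>p \<noteq> []\<close> \<open>m < n\<close> that by (auto simp: arc_underlying)
  qed
  show ?thesis using *[of i j] *[of j i] ij arc by (meson linorder_neqE_nat)
qed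

text \<open>
  The arcs are the pairs of a vertex and its unique parent, which is always on the handle.
\<close>

locale broom_digraph = broom "pverts G" x d h t
  for G :: "'v pair_pre_digraph" and x d h t +
  assumes arc_iff: "(u, v) \<in> parcs G \<longleftrightarrow> v \<in> pverts G \<and> 1 \<le> d v \<and> u = x (d v - 1)"

lemma broom_digraph_if_broom_handle:
  assumes t: "2 \<le> t" and G: "directed_tree G" and xs: "broom_handle G r h xs"
  obtains d where "broom_digraph G ((!) xs) d h t"
proof -
  have path: "vpath xs (with_proj G)" and len: "length xs = Suc h" and dist: "distinct xs"
    and sub: "set xs \<subseteq> pverts G"
    and leaf: "\<And>v. v \<in> pverts G \<Longrightarrow> v \<notin> set xs \<Longrightarrow> (\<forall>w. (v, w) \<notin> parcs G) \<and> (\<exists>j<h. (xs ! j, v) \<in> parcs G)"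
    using xs by (auto simp: broom_handle_def vpath_def vwalk_def)
  interpret G: pair_digraph G using G by (simp add: directed_tree_def)
  define parent where "parent v = (SOME j. j < h \<and> (xs ! j, v) \<in> parcs G)" for v
  have parent: "parent v < h" "(xs ! parent v, v) \<in> parcs G" if "v \<in> pverts G" "v \<notin> set xs" for v
    using someI_ex[of "\<lambda>j. j < h \<and> (xs ! j, v) \<in> parcs G"] leaf[OF that] by (auto simp: parent_def)
  define d where "d v = (if v \<in> set xs then THE i. i \<le> h \<and> xs ! i = v else Suc (parent v))" for v
  have d_handle: "d (xs ! i) = i" if "i \<le> h" for i
  proof -
    have "(THE j. j \<le> h \<and> xs ! j = xs ! i) = i"
      using that len dist by (intro the_equality) (auto simp: nth_eq_iff_index_eq)
    then show ?thesis using that len by (simp add: d_def)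
  qed
  have d_leaf: "d v = Suc (parent v)" if "v \<notin> set xs" for v
    using that by (simp add: d_def)
  have on_handle: "\<exists>i\<le>h. v = xs ! i" if "v \<in> set xs" for v
    using that len by (metis in_set_conv_nth less_Suc_eq_le)
  have "broom_digraph G ((!) xs) d h t"
  proof unfold_locales
    show "finite (pverts G)" by simp
    show "xs ! i \<in> pverts G" if "i \<le> h" for i using that len sub by auto
    show "d (xs ! i) = i" if "i \<le> h" for i using d_handle that .
    show "2 \<le> t" by (rule t)
    show "d v \<le> h" if "v \<in> pverts G" for v
      using that d_handle on_handle[of v] d_leaf[of v] parent[of v] by (cases "v \<in> set xs") (auto simp: Suc_le_eq)
    show "(u, v) \<in> parcs G \<longleftrightarrow> v \<in> pverts G \<and> 1 \<le> d v \<and> u = xs ! (d v - 1)" for u v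
    proof
      assume arc: "(u, v) \<in> parcs G"
      then have uv: "u \<in> pverts G" "v \<in> pverts G" using G.in_arcsD1 G.in_arcsD2 by auto
      with arc leaf have "u \<in> set xs" by blast
      then obtain i where i: "u = xs ! i" "i \<le> h" using on_handle by blast
      show "v \<in> pverts G \<and> 1 \<le> d v \<and> u = xs ! (d v - 1)"
      proof (cases "v \<in> set xs")
        case True
        then obtain j where j: "v = xs ! j" "j \<le> h" using on_handle by blast
        then have "j = Suc i" using directed_tree_no_chord[OF G path, of i j] arc i len by simp
        then show ?thesis using uv i j d_handle[of j] by simp
      next
        case False
        then have "i = parent v"
          using directed_tree_unique_parent[OF G path False, of i "parent v"] arc i len parent[OF uv(2) False]
          by simp
        then show ?thesis using uv i False by (simp add: d_leaf)
      qed
    next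
      assume v: "v \<in> pverts G \<and> 1 \<le> d v \<and> u = xs ! (d v - 1)"
      show "(u, v) \<in> parcs G"
      proof (cases "v \<in> set xs")
        case True
        then obtain j where j: "v = xs ! j" "j \<le> h" using on_handle by blast
        then obtain i where "j = Suc i" using v d_handle[of j] by (cases j) auto
        then show ?thesis
          using j v len vwalk_arcs_nth[of i xs] path d_handle[of j] by (auto simp: vpath_def vwalk_def)
      next
        case False
        then show ?thesis using v parent by (simp add: d_leaf)
      qed
    qed
  qed
  then show ?thesis by (rule that)
qed

context broom_digraph
begin

text \<open>
  Going backwards from its last vertex, a walk has no choice: the parent of each vertex is the
  handle vertex one level up.
\<close>

lemma vwalk_shape:
  assumes "vwalk p (with_proj G)"
  shows "length p \<le> d (last p) + 1 \<and> set p = insert (last p) (x ` {d (last p) + 1 - length p..<d (last p)})"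
  using assms
proof (induction p rule: rev_induct)
  case (snoc v p)
  show ?case
  proof (cases "p = []")
    case False
    with snoc.prems have p: "vwalk p (with_proj G)" and v: "v \<in> pverts G" "1 \<le> d v" "last p = x (d v - 1)"
      by (simp_all add: vwalk_snoc arc_iff)
    have dp: "d (last p) = d v - 1"
      using v depth_le[of v] depth_handle[of "d v - 1"] by simp
    note IH = snoc.IH[OF p, unfolded dp]
    have "insert (d v - 1) {d v - length p..<d v - 1} = {d v - length p..<d v}"
      using v(2) False by (cases p) auto
    moreover have "set p = x ` insert (d v - 1) {d v - length p..<d v - 1}"
      using IH v by simp
    ultimately have "set p = x ` {d v - length p..<d v}" by simp
    then show ?thesis using IH v(2) by auto
  qed simp
qed (simp add: vwalk_def)

lemma exists_vpath_to:
  assumes "v \<in> pverts G" "Suc n \<le> d v + 1"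
  shows "\<exists>p. vpath p (with_proj G) \<and> length p = Suc n \<and> last p = v"
  using assms
proof (induction n arbitrary: v)
  case 0
  then show ?case by (intro exI[of _ "[v]"]) (auto simp: vpath_def vwalk_def)
next
  case (Suc n)
  let ?u = "x (d v - 1)"
  have u: "?u \<in> pverts G" "d ?u = d v - 1"
    using Suc.prems depth_le[of v] handle_in_V[of "d v - 1"] depth_handle[of "d v - 1"] by auto
  then obtain p where p: "vpath p (with_proj G)" "length p = Suc n" "last p = ?u"
    using Suc.IH[of ?u] Suc.prems by auto
  have "p \<noteq> []" using p by auto
  have walk: "vwalk p (with_proj G)" using p by (simp add: vpath_def)
  have "v \<notin> set p"
  proof
    assume "v \<in> set p"
    with vwalk_shape[OF walk] p(3) u(2)
    have "v = x (d v - 1) \<or> v \<in> x ` {d v - 1 + 1 - length p..<d v - 1}"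
      by simp
    moreover have "d v - 1 < d v" using Suc.prems by simp
    ultimately have "\<exists>i<d v. v = x i"
      by (elim disjE imageE) (auto intro: less_trans)
    then obtain i where "i < d v" "v = x i" by blast
    with depth_le[of v] depth_handle[of i] Suc.prems(1) show False by simp
  qed
  then have "vpath (p @ [v]) (with_proj G)"
    using p walk Suc.prems \<open>p \<noteq> []\<close> by (simp add: vpath_def vwalk_snoc arc_iff)
  with p show ?case by (intro exI[of _ "p @ [v]"]) simp
qed

lemma directed_path_sets: "set ` {p. directed_path t G p} = path_to ` ends"
proof (intro equalityI subsetI)
  fix F assume "F \<in> set ` {p. directed_path t G p}"
  then obtain p where p: "F = set p" "vwalk p (with_proj G)" "length p = t"
    by (auto simp: directed_path_def vpath_def)
  have "last p \<in> pverts G" using p by (auto simp: vwalk_def)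
  then show "F \<in> path_to ` ends"
    using vwalk_shape[OF p(2)] p by (intro image_eqI[of _ _ "last p"]) (auto simp: path_to_def ends_def)
next
  fix F assume "F \<in> path_to ` ends"
  then obtain v where v: "F = path_to v" "v \<in> pverts G" "t \<le> d v + 1" by (auto simp: ends_def)
  then obtain p where p: "vpath p (with_proj G)" "length p = t" "last p = v"
    using exists_vpath_to[of v "t - 1"] two_le_t by auto
  then have "set p = F"
    using vwalk_shape[of p] v by (simp add: vpath_def path_to_def)
  then show "F \<in> set ` {p. directed_path t G p}" using p by (auto simp: directed_path_def)
qed

text \<open>
  All sets \<open>path_to v\<close> with \<open>v\<close> in \<open>ends\<close> have \<open>t\<close> elements, so none of them is properly contained
  in another.
\<close>

lemma facets_path_complex: "facets (path_complex t G) = path_to ` ends"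
proof -
  have complex: "path_complex t G = {F. \<exists>v\<in>ends. F \<subseteq> path_to v}"
  proof -
    have "path_complex t G = {F. \<exists>H\<in>set ` {p. directed_path t G p}. F \<subseteq> H}"
      by (auto simp: path_complex_def)
    then show ?thesis unfolding directed_path_sets by simp
  qed
  have same: "path_to u = path_to v" if "u \<in> ends" "v \<in> ends" "path_to u \<subseteq> path_to v" for u v
    by (rule card_subset_eq[OF finite_path_to that(3)]) (simp add: card_path_to that)
  show ?thesis
  proof (intro equalityI subsetI)
    fix F assume "F \<in> facets (path_complex t G)"
    then show "F \<in> path_to ` ends" by (auto simp: facets_def complex)
  next
    fix F assume "F \<in> path_to ` ends"
    then obtain u where u: "u \<in> ends" "F = path_to u" by auto
    have "F = H" if "F \<subseteq> H" "v \<in> ends" "H \<subseteq> path_to v" for H v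
      using same[OF u(1) that(2)] that u(2) by auto
    with u show "F \<in> facets (path_complex t G)"
      by (auto simp: facets_def complex)
  qed
qed

lemma matching_path_to:
  assumes "end_matching Y"
  shows "matching (path_complex t G) (path_to ` Y)" "card (path_to ` Y) = card Y"
proof -
  show "matching (path_complex t G) (path_to ` Y)"
    unfolding matching_def facets_path_complex
  proof (intro conjI ballI impI)
    show "path_to ` Y \<subseteq> path_to ` ends" using assms by (intro image_mono) (simp add: end_matching_def)
    fix F H assume "F \<in> path_to ` Y" "H \<in> path_to ` Y" "F \<noteq> H"
    then obtain u v where "u \<in> Y" "v \<in> Y" "F = path_to u" "H = path_to v" "u \<noteq> v" by auto
    with assms show "F \<inter> H = {}" by (simp add: end_matching_def)
  qed
  show "card (path_to ` Y) = card Y"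
    using assms inj_on_subset[OF path_to_inj] by (intro card_image) (simp add: end_matching_def)
qed

lemma finite_matchings: "finite {M. matching (path_complex t G) M}"
  by (rule finite_subset[of _ "Pow (path_to ` ends)"])
    (auto simp: matching_def facets_path_complex finite_ends)

lemma card_le_matching_number:
  assumes "end_matching Y"
  shows "card Y \<le> matching_number (path_complex t G)"
proof -
  have "card Y \<in> card ` {M. matching (path_complex t G) M}"
    using matching_path_to[OF assms] by (intro image_eqI[of _ _ "path_to ` Y"]) simp_all
  then show ?thesis
    unfolding matching_number_def using finite_matchings by (intro Max_ge finite_imageI)
qed

lemma restricted_matching_number_path:
  assumes V: "pverts G = x ` {..h}"
  shows "h < Suc (restricted_matching_number (path_complex t G)) * t"
proof (rule ccontr)
  let ?k = "restricted_matching_number (path_complex t G)"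
  assume "\<not> h < Suc ?k * t"
  then obtain W w where W: "end_matching W" "card W = Suc ?k" "w \<in> W"
    and gap: "\<And>v u. v \<in> W - {w} \<Longrightarrow> u \<in> ends \<Longrightarrow> path_to u \<subseteq> path_to w \<union> path_to v \<Longrightarrow> u = w \<or> u = v"
    using exists_spread_end_matching[OF V, of ?k] by (metis not_less)
  have "gap (path_complex t G) (path_to w) F" if F: "F \<in> path_to ` W - {path_to w}" for F
  proof -
    from F obtain v where v: "F = path_to v" "v \<in> W - {w}" by auto
    have wv: "w \<in> ends" "v \<in> ends" "path_to w \<inter> path_to v = {}"
      using W(1,3) v(2) by (auto simp: end_matching_def)
    show ?thesis
      unfolding gap_def facets_path_complex v(1)
    proof (intro conjI ballI impI)
      fix L assume "L \<in> path_to ` ends" "L \<subseteq> path_to w \<union> path_to v"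
      then show "L = path_to w \<or> L = path_to v" using gap[OF v(2)] by auto
    qed (use wv in simp_all)
  qed
  then have "restricted_matching (path_complex t G) (path_to ` W)"
    using W(3) matching_path_to(1)[OF W(1)] unfolding restricted_matching_def by blast
  moreover have "finite {M. restricted_matching (path_complex t G) M}"
    by (rule finite_subset[OF _ finite_matchings]) (auto simp: restricted_matching_def)
  ultimately have "card (path_to ` W) \<le> ?k"
    unfolding restricted_matching_number_def by (intro Max_ge) auto
  then show False using matching_path_to[OF W(1)] W by simp
qed

text \<open>
  A sum of path indicators has entries at most 1 only if the paths are pairwise disjoint, in
  particular distinct.
\<close>

lemma squarefree_sums_of_paths:
  "{m \<in> sums_of (indicator_exp ` path_to ` ends) k. \<forall>v. Poly_Mapping.lookup m v \<le> 1} =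
    indicator_exp ` support ` {Y. end_matching Y \<and> card Y = k}" (is "?S k = ?M k")
proof (intro equalityI subsetI)
  have fin: "finite (support Y)" if "end_matching Y" for Y
    using end_matching_finite[OF that] finite_path_to by (rule finite_UN_I)
  have M_I: "m \<in> ?M k" if "end_matching Y" "card Y = k" "m = indicator_exp (support Y)" for m Y k
    unfolding that(3) by (intro imageI CollectI conjI that(1,2))
  show "m \<in> ?M k" if "m \<in> ?S k" for m
    using that
  proof (induction k arbitrary: m)
    case 0
    have "end_matching {}" by (simp add: end_matching_def)
    moreover have "m = indicator_exp (support {})" using 0 by (simp add: indicator_exp_def)
    ultimately show ?case by (intro M_I[of "{}"]) simp_all
  next
    case (Suc k)
    then obtain a v where m: "m = a + indicator_exp (path_to v)" "a \<in> sums_of (indicator_exp ` path_to ` ends) k"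
      "v \<in> ends" and le: "\<And>u. Poly_Mapping.lookup m u \<le> 1" by auto
    have le': "Poly_Mapping.lookup a u + Poly_Mapping.lookup (indicator_exp (path_to v)) u \<le> 1" for u
      using le[of u] by (simp add: m lookup_add)
    have "Poly_Mapping.lookup a u \<le> 1" for u using le'[of u] by simp
    with m(2) have "a \<in> ?S k" by blast
    then have "a \<in> ?M k" by (rule Suc.IH)
    then obtain Y where Y: "a = indicator_exp (support Y)" "end_matching Y" "card Y = k"
      unfolding image_iff by blast
    have "u \<notin> path_to v" if "u \<in> support Y" for u
      using le'[of u] that unfolding Y(1) lookup_indicator_exp[OF fin[OF Y(2)]]
        lookup_indicator_exp[OF finite_path_to] by (simp split: if_splits)
    then have disj: "support Y \<inter> path_to v = {}" by blast
    have "v \<in> path_to v" by (simp add: path_to_def)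
    with disj have "v \<notin> Y" by blast
    have "path_to v \<inter> path_to u = {}" if "u \<in> Y" for u
      using disj that by blast
    then have "end_matching (insert v Y)"
      using Y(2) m(3) by (auto simp: end_matching_def Int_commute)
    moreover have "card (insert v Y) = Suc k" using Y end_matching_finite \<open>v \<notin> Y\<close> by simp
    moreover have "m = indicator_exp (support (insert v Y))"
      using indicator_exp_Un[OF fin[OF Y(2)] finite_path_to disj] by (simp add: m Y Un_commute)
    ultimately show ?case by (rule M_I)
  qed
  show "m \<in> ?S k" if m: "m \<in> ?M k" for m
  proof -
    have "indicator_exp (support Y) \<in> sums_of (indicator_exp ` path_to ` ends) (card Y)"
      if "finite Y" "end_matching Y" for Y
      using that
    proof (induction Y rule: finite_induct)
      case empty
      show ?case by (simp add: indicator_exp_def)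
    next
      case (insert v Y)
      from insert.prems have Y: "end_matching Y" "v \<in> ends" by (simp_all add: end_matching_def)
      have "path_to u \<inter> path_to v = {}" if "u \<in> Y" for u
      proof -
        have "u \<noteq> v" using that insert.hyps(2) by auto
        with that insert.prems show ?thesis by (simp add: end_matching_def)
      qed
      then have "support Y \<inter> path_to v = {}" by auto
      then have "indicator_exp (support (insert v Y)) = indicator_exp (support Y) + indicator_exp (path_to v)"
        using indicator_exp_Un[OF fin[OF Y(1)] finite_path_to] by (simp add: Un_commute)
      then have sum: "indicator_exp (support (insert v Y)) =
          (\<lambda>(a, b). a + b) (indicator_exp (support Y), indicator_exp (path_to v))"
        by simp
      have "(indicator_exp (support Y), indicator_exp (path_to v)) \<in>
          sums_of (indicator_exp ` path_to ` ends) (card Y) \<times> indicator_exp ` path_to ` ends"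
        using insert.IH[OF Y(1)] Y(2) by simp
      with sum have "indicator_exp (support (insert v Y)) \<in> sums_of (indicator_exp ` path_to ` ends) (Suc (card Y))"
        unfolding sums_of.simps by (rule image_eqI)
      with insert.hyps show ?case by simp
    qed
    moreover obtain Y where Y: "m = indicator_exp (support Y)" "end_matching Y" "card Y = k"
      using m unfolding image_iff by blast
    moreover have "Poly_Mapping.lookup m u \<le> 1" for u
      unfolding Y(1) lookup_indicator_exp[OF fin[OF Y(2)]] by simp
    ultimately show ?thesis using end_matching_finite[OF Y(2)] by blast
  qed
qed

lemma linear_quotients_if_exchangeable:
  assumes "exchangeable k"
  shows "linear_quotients (pverts G)
    (squarefree_power (pverts G) (facet_ideal (pverts G) (path_complex t G)) k :: ('v, 'k::field) mpoly set)"
proof -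
  obtain Us where Us: "set Us = support ` {Y. end_matching Y \<and> card Y = k}"
    "\<And>i j. j < i \<Longrightarrow> i < length Us \<Longrightarrow> \<exists>l<i. \<exists>v. Us ! l - Us ! i = {v} \<and> v \<in> Us ! j"
    using exists_linear_quotient_order[OF assms] by blast
  have "squarefree_power (pverts G) (facet_ideal (pverts G) (path_complex t G)) k =
    (mon_ideal (pverts G) (indicator_exp ` set Us) :: ('v, 'k) mpoly set)"
    unfolding Us(1) squarefree_sums_of_paths[symmetric] facets_path_complex[symmetric]
    using path_to_subset_V card_path_to finite_V
    by (intro squarefree_power_facet_ideal[of _ _ t]) (auto simp: facets_path_complex)
  moreover have "U \<subseteq> pverts G" if "U \<in> set Us" for U
    using that path_to_subset_V by (auto simp: Us(1) end_matching_def)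
  ultimately show ?thesis
    using linear_quotients_mon_ideal[OF finite_V _ Us(2)] by simp
qed

end

section \<open>Linear quotients of the squarefree powers\<close>

theorem theorem2p7:
  fixes G :: "'v pair_pre_digraph" and r :: 'v and h t :: nat
    and I :: "('v, 'k::field) mpoly set"
  assumes "2 \<le> t"
    and "broom_graph G r h"
    and "\<exists>p. directed_path t G p"
    and "I = facet_ideal (pverts G) (path_complex t G)"
  shows "linear_quotients (pverts G)
           (squarefree_power (pverts G) I (matching_number (path_complex t G))) \<and>
         (path_graph G r \<longrightarrow>
           linear_quotients (pverts G)
             (squarefree_power (pverts G) I (restricted_matching_number (path_complex t G))))"
proof (intro conjI impI)
  obtain xs where tree: "directed_tree G" and xs: "broom_handle G r h xs"
    using assms(2) by (auto simp: broom_graph_def rooted_tree_def)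
  obtain d where "broom_digraph G ((!) xs) d h t"
    using broom_digraph_if_broom_handle[OF assms(1) tree xs] by blast
  then interpret broom_digraph G "(!) xs" d h t .
  show "linear_quotients (pverts G) (squarefree_power (pverts G) I (matching_number (path_complex t G)))"
    unfolding assms(4)
    by (intro linear_quotients_if_exchangeable exchangeable_if_maximal card_le_matching_number)
next
  assume "path_graph G r"
  then obtain h' ys where tree: "directed_tree G" and ys: "broom_handle G r h' ys" "pverts G = set ys"
    by (auto simp: path_graph_def rooted_tree_def)
  obtain d where "broom_digraph G ((!) ys) d h' t"
    using broom_digraph_if_broom_handle[OF assms(1) tree ys(1)] by blast
  then interpret broom_digraph G "(!) ys" d h' t .
  have "pverts G = (!) ys ` {..h'}"
    using ys by (auto simp: broom_handle_def set_conv_nth less_Suc_eq_le)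
  then show "linear_quotients (pverts G) (squarefree_power (pverts G) I (restricted_matching_number (path_complex t G)))"
    unfolding assms(4)
    by (intro linear_quotients_if_exchangeable exchangeable_path restricted_matching_number_path)
qed

end
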